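(* Let $G_m$ be a bounded Vilenkin group, let $1\le p<\infty$, let $\{q_k:k\in\mathbb{N}\}$ be a sequence of non-negative numbers with $q_0>0$, put $Q_n:=\sum_{k=0}^{n-1}q_k$, and let $T_nf:=\frac{1}{Q_n}\sum_{k=0}^{n-1}q_kS_kf$ be the associated $T$ means of the Vilenkin-Fourier series of $f$. (a) Suppose that $\{q_k\}$ is non-increasing. Then: (i) $\|T_nf-f\|_p\to 0$ as $n\to\infty$ for all $f\in L_p(G_m)$; (ii) if $f\in L_1(G_m)$ is continuous at a point $x\in G_m$, then $T_nf(x)\to f(x)$ as $n\to\infty$; (iii) $\lim_{n\to\infty}T_nf(x)=f(x)$ for every $f\in L_p(G_m)$ and every Vilenkin-Lebesgue point $x$ of $f$. (b) Suppose that $\{q_k\}$ is non-decreasing and satisfies $\frac{q_{n-1}}{Q_n}=O\left(\frac1n\right)$ as $n\to\infty$. Then: (i) $\|T_nf-f\|_p\to 0$ as $n\to\infty$ for all $f\in L_p(G_m)$; (ii) if $f\in L_1(G_m)$ is continuous at a point $x\in G_m$, then $T_nf(x)\to f(x)$ as $n\to\infty$; (iii) $\lim_{n\to\infty}T_nf(x)=f(x)$ for every $f\in L_p(G_m)$ and every Vilenkin-Lebesgue point $x$ of $f$.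
   Context: $\mathbb{N}=\{0,1,2,\dots\}$, $\mathbb{N}_+=\{1,2,\dots\}$. Let $m=(m_0,m_1,\dots)$ be a sequence of integers $m_k\ge 2$ with $\sup_k m_k<\infty$ (bounded case), and $Z_{m_k}=\{0,1,\dots,m_k-1\}$ the additive group of integers modulo $m_k$ with the discrete topology. The Vilenkin group $G_m=\prod_{k\ge0}Z_{m_k}$ is the complete direct product with the product topology; its elements are sequences $x=(x_0,x_1,\dots)$, $x_k\in Z_{m_k}$; $\mu$ is the normalized Haar measure, i.e. the product of the uniform probability measures on the $Z_{m_k}$. $L_p(G_m)$ is the Lebesgue space with respect to $\mu$, with norm $\|f\|_p=(\int_{G_m}|f|^p\,d\mu)^{1/p}$. Put $M_0=1$, $M_{k+1}=m_kM_k$; each $n\in\mathbb{N}$ is uniquely $n=\sum_{j\ge0}n_jM_j$ with $n_j\in Z_{m_j}$. Put $I_0(x)=G_m$ and $I_n(x)=\{y\in G_m: y_0=x_0,\dots,y_{n-1}=x_{n-1}\}$ for $n\ge1$. Generalized Rademacher functions: $r_k(x)=\exp(2\pi i x_k/m_k)$. Vilenkin system: $\psi_n(x)=\prod_{k\ge0}r_k(x)^{n_k}$. For $f\in L_1(G_m)$: $\widehat f(n)=\int_{G_m}f\overline{\psi_n}\,d\mu$, $S_nf=\sum_{k=0}^{n-1}\widehat f(k)\psi_k$ for $n\ge1$, and $S_0f=0$. Let $e_s\in G_m$ be the element whose $s$-th coordinate is $1$ and all of whose other coordinates are $0$. A point $x\in G_m$ is a Vilenkin-Lebesgue point of $f\in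 L_1(G_m)$ if $\lim_{n\to\infty}W_nf(x)=0$, where $$W_nf(x):=\sum_{s=0}^{n-1}M_s\sum_{r=1}^{m_s-1}\int_{I_n(x-re_s)}|f(t)-f(x)|\,d\mu(t).$$
   Formalization: Part (a) is proved under the additional hypothesis that Q_n tends to infinity; without it (a) is false, since for f = 1 one has T_n f = 1 - q_0/Q_n, which tends to 1 only if Q_n is unbounded (for instance q_0 = 1 and q_k = 0 for k ≥ 1 gives T_n f = 0). *)

theory Defs
  imports "HOL-Probability.Probability" "HOL-Algebra.Product_Groups" "HOL-Library.Landau_Symbols"
begin

abbreviation vil_Z :: "(nat \<Rightarrow> nat) \<Rightarrow> nat \<Rightarrow> int monoid" where
  "vil_Z m k \<equiv> integer_mod_group (m k)"

definition vil_group :: "(nat \<Rightarrow> nat) \<Rightarrow> (nat \<Rightarrow> int) monoid" where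
  "vil_group m = product_group UNIV (vil_Z m)"

definition vil_top :: "(nat \<Rightarrow> nat) \<Rightarrow> (nat \<Rightarrow> int) topology" where
  "vil_top m = product_topology (\<lambda>k. discrete_topology (carrier (vil_Z m k))) UNIV"

definition vil_measure :: "(nat \<Rightarrow> nat) \<Rightarrow> (nat \<Rightarrow> int) measure" where
  "vil_measure m = PiM UNIV (\<lambda>k. uniform_count_measure (carrier (vil_Z m k)))"

definition vil_e :: "nat \<Rightarrow> nat \<Rightarrow> int" where
  "vil_e s = (\<lambda>k. if k = s then 1 else 0)"

definition vil_M :: "(nat \<Rightarrow> nat) \<Rightarrow> nat \<Rightarrow> nat" where
  "vil_M m k = (\<Prod>j<k. m j)"

definition vil_digit :: "(nat \<Rightarrow> nat) \<Rightarrow> nat \<Rightarrow> nat \<Rightarrow> nat" where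
  "vil_digit m n j = n div vil_M m j mod m j"

text \<open>The two lemmas below confirm that \<^const>\<open>vil_digit\<close> yields the expansion
  \<open>n = (\<Sum>j. n\<^sub>j M\<^sub>j)\<close> with \<open>n\<^sub>j < m\<^sub>j\<close>; only indices \<open>j < n\<close> contribute.\<close>

lemma vil_digit_less: "m j \<ge> 2 \<Longrightarrow> vil_digit m n j < m j"
  by (simp add: vil_digit_def)

lemma vil_digit_expansion:
  assumes "\<And>k. m k \<ge> 2"
  shows "n = (\<Sum>j<n. vil_digit m n j * vil_M m j)" and "j \<ge> n \<Longrightarrow> vil_digit m n j = 0"
proof -
  have lt: "n < vil_M m n" for n
  proof (induction n)
    case (Suc n)
    have "Suc n < 2 * vil_M m n" using Suc by linarith
    also have "2 * vil_M m n \<le> vil_M m (Suc n)"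
      using assms[of n] by (simp add: vil_M_def)
    finally show ?case .
  qed (simp add: vil_M_def)
  have "n mod vil_M m N = (\<Sum>j<N. vil_digit m n j * vil_M m j)" for N
  proof (induction N)
    case (Suc N)
    have "vil_M m (Suc N) = vil_M m N * m N" by (simp add: vil_M_def)
    then have "n mod vil_M m (Suc N) = vil_M m N * vil_digit m n N + n mod vil_M m N"
      by (simp only: mod_mult2_eq vil_digit_def)
    then show ?case using Suc by (simp add: mult.commute)
  qed (simp add: vil_M_def)
  from this[of n] show "n = (\<Sum>j<n. vil_digit m n j * vil_M m j)"
    using lt[of n] by simp
  show "vil_digit m n j = 0" if "j \<ge> n"
    using lt[of j] that by (simp add: vil_digit_def)
qed

definition vil_I :: "(nat \<Rightarrow> nat) \<Rightarrow> nat \<Rightarrow> (nat \<Rightarrow> int) \<Rightarrow> (nat \<Rightarrow> int) set" where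
  "vil_I m n x = {y \<in> carrier (vil_group m). \<forall>j<n. y j = x j}"

definition vil_rad :: "(nat \<Rightarrow> nat) \<Rightarrow> nat \<Rightarrow> (nat \<Rightarrow> int) \<Rightarrow> complex" where
  "vil_rad m k x = exp (2 * of_real pi * \<i> * of_int (x k) / of_nat (m k))"

definition vil_psi :: "(nat \<Rightarrow> nat) \<Rightarrow> nat \<Rightarrow> (nat \<Rightarrow> int) \<Rightarrow> complex" where
  "vil_psi m n x = (\<Prod>k. vil_rad m k x ^ vil_digit m n k)"

definition vil_Lp :: "(nat \<Rightarrow> nat) \<Rightarrow> real \<Rightarrow> ((nat \<Rightarrow> int) \<Rightarrow> complex) set" where
  "vil_Lp m p = {f \<in> borel_measurable (vil_measure m).
     integrable (vil_measure m) (\<lambda>x. norm (f x) powr p)}"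

definition vil_norm :: "(nat \<Rightarrow> nat) \<Rightarrow> real \<Rightarrow> ((nat \<Rightarrow> int) \<Rightarrow> complex) \<Rightarrow> real" where
  "vil_norm m p f = (LINT x|vil_measure m. norm (f x) powr p) powr (1 / p)"

definition vil_coeff :: "(nat \<Rightarrow> nat) \<Rightarrow> ((nat \<Rightarrow> int) \<Rightarrow> complex) \<Rightarrow> nat \<Rightarrow> complex" where
  "vil_coeff m f n = (LINT t|vil_measure m. f t * cnj (vil_psi m n t))"

definition vil_S :: "(nat \<Rightarrow> nat) \<Rightarrow> nat \<Rightarrow> ((nat \<Rightarrow> int) \<Rightarrow> complex) \<Rightarrow> (nat \<Rightarrow> int) \<Rightarrow> complex" where
  "vil_S m n f x = (\<Sum>k<n. vil_coeff m f k * vil_psi m k x)"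

definition Q_sum :: "(nat \<Rightarrow> real) \<Rightarrow> nat \<Rightarrow> real" where
  "Q_sum q n = (\<Sum>k<n. q k)"

definition T_mean :: "(nat \<Rightarrow> nat) \<Rightarrow> (nat \<Rightarrow> real) \<Rightarrow> nat \<Rightarrow> ((nat \<Rightarrow> int) \<Rightarrow> complex) \<Rightarrow> (nat \<Rightarrow> int) \<Rightarrow> complex" where
  "T_mean m q n f x = 1 / of_real (Q_sum q n) * (\<Sum>k<n. of_real (q k) * vil_S m k f x)"

definition vil_shift :: "(nat \<Rightarrow> nat) \<Rightarrow> (nat \<Rightarrow> int) \<Rightarrow> nat \<Rightarrow> nat \<Rightarrow> nat \<Rightarrow> int" where
  "vil_shift m x r s =
     x \<otimes>\<^bsub>vil_group m\<^esub> (inv\<^bsub>vil_group m\<^esub> (vil_e s [^]\<^bsub>vil_group m\<^esub> r))"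

lemma vil_shift_eq:
  assumes "\<And>k. m k \<ge> 2" and x: "x \<in> carrier (vil_group m)"
  shows "vil_shift m x r s = (\<lambda>k. (x k - (if k = s then int r else 0)) mod int (m k))"
proof -
  have pow: "vil_e s [^]\<^bsub>vil_group m\<^esub> r = (\<lambda>k. (if k = s then int r else 0) mod int (m k))" for r
    by (induction r) (auto simp: vil_group_def vil_e_def nat_pow_def product_group_def fun_eq_iff mod_simps add.commute)
  have pos: "m k > 0" for k using assms(1)[of k] by linarith
  have "(\<lambda>k. (if k = s then int r else 0) mod int (m k)) \<in> carrier (product_group UNIV (vil_Z m))"
    using pos by (auto simp: carrier_integer_mod_group)
  then have "inv\<^bsub>vil_group m\<^esub> (vil_e s [^]\<^bsub>vil_group m\<^esub> r) =
      (\<lambda>k. (- ((if k = s then int r else 0) mod int (m k))) mod int (m k))"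
    unfolding pow using pos by (subst vil_group_def, subst inv_product_group)
      (auto simp: carrier_integer_mod_group fun_eq_iff)
  then show ?thesis
    unfolding vil_shift_def
    by (auto simp: vil_group_def fun_eq_iff mod_simps)
qed

definition vil_W :: "(nat \<Rightarrow> nat) \<Rightarrow> nat \<Rightarrow> ((nat \<Rightarrow> int) \<Rightarrow> complex) \<Rightarrow> (nat \<Rightarrow> int) \<Rightarrow> real" where
  "vil_W m n f x = (\<Sum>s<n. real (vil_M m s) *
     (\<Sum>r=1..m s - 1. LINT t:vil_I m n (vil_shift m x r s)|vil_measure m. norm (f t - f x)))"

definition vil_lebesgue_point :: "(nat \<Rightarrow> nat) \<Rightarrow> ((nat \<Rightarrow> int) \<Rightarrow> complex) \<Rightarrow> (nat \<Rightarrow> int) \<Rightarrow> bool" where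
  "vil_lebesgue_point m f x \<longleftrightarrow>
     f \<in> vil_Lp m 1 \<and> x \<in> carrier (vil_group m) \<and> (\<lambda>n. vil_W m n f x) \<longlonglongrightarrow> 0"

end

theory Submission
  imports Defs
begin

text \<open>Abel summation writes \<open>T\<^sub>n f\<close> as a combination of Fejer means whose coefficients have
  bounded absolute sum. Writing \<open>n\<close> in the mixed radix \<open>m\<close> and splitting off its leading digit
  shows that the \<open>n\<close>-th Fejer kernel is at most a constant times
  \<open>(1/n) \<Sum> M\<^sub>l B\<^sub>l\<close>, the sum being over \<open>l\<close> with \<open>M\<^sub>l \<le> n\<close>, where
  \<open>B\<^sub>l(x, t) = \<Sum>s\<le>l. M\<^sub>s [t\<^sub>j = x\<^sub>j for all j < l with j \<noteq> s]\<close> has bounded integral.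
  Hence the kernel of \<open>T\<^sub>n\<close> is dominated by an average \<open>\<Sum> \<rho>(n,l) B\<^sub>l\<close> in which each
  \<open>\<rho>(n,l)\<close> vanishes as \<open>n\<close> grows, so \<open>T\<^sub>n f(x)\<close> converges to \<open>f(x)\<close> as soon as
  \<open>\<integral> |f(t) - f(x)| B\<^sub>l(x, t) dt\<close> tends to 0; this holds at continuity points and at
  Vilenkin-Lebesgue points. The same domination with Jensen's inequality and Fubini's theorem bounds
  \<open>T\<^sub>n\<close> on \<open>L\<^sub>p\<close> uniformly in \<open>n\<close>, so norm convergence extends from cylinder sets, where
  it follows from pointwise convergence, to all of \<open>L\<^sub>p\<close>.\<close>

subsection \<open>Dirichlet and Fejer kernels\<close>

text \<open>Because S_0 f = 0, the means of the constant 1 equal 1 - q_0/Q_n, so even for constants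
  convergence forces Q_n to tend to infinity; the weights 1, 0, 0, ... give T_n f = 0. Part (a) of
  the formal theorem therefore assumes that \<open>Q_sum q\<close> diverges, while in part (b) this
  follows from q_k >= q_0 > 0.

  Beyond nonnegativity and q_0 > 0, either class of weights enters only through two estimates: one
  on the variation of q weighted by k + 1 (bounded mass of the kernel), one on the unweighted
  variation (no mass stays at a fixed level l).

  The obstacle is that Fejer kernels do not concentrate on I_l(x): they also live on cylinders where
  one coordinate s < l is free, with weight M_s. For small s these sets reach far from x, but their
  weighted measure is only of order M_s/M_l. Hence the deviation is split by s, and
  Vilenkin-Lebesgue points test the shifts x - r e_s. Boundedness of m enters when digits are
  estimated by b and when freeing coordinate s enlarges a measure by the factor m_s <= b.\<close>

locale bounded_vilenkin =
  fixes m :: "nat \<Rightarrow> nat" and b :: nat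
  assumes m_ge_2: "m k \<ge> 2" and m_le: "m k \<le> b"
begin

section \<open>Mixed-radix arithmetic: growth of the bases and digits\<close>

abbreviation M :: "nat \<Rightarrow> nat" where "M \<equiv> vil_M m"

lemma m_pos: "m k > 0"
  using m_ge_2[of k] by linarith

lemma b_ge_2: "b \<ge> 2"
  using m_ge_2[of 0] m_le[of 0] by linarith

lemma M_0: "M 0 = 1"
  by (simp add: vil_M_def)

lemma M_Suc: "M (Suc k) = M k * m k"
  by (simp add: vil_M_def)

lemma M_pos: "M k > 0"
  using m_pos by (simp add: vil_M_def)

lemma M_dvd: "k \<le> l \<Longrightarrow> M k dvd M l"
  unfolding vil_M_def by (intro prod_dvd_prod_subset) auto

lemma M_mono: "k \<le> l \<Longrightarrow> M k \<le> M l"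
  using M_dvd M_pos dvd_imp_le by blast

lemma less_M: "n < M n"
proof (induction n)
  case (Suc n)
  have "Suc n < 2 * M n" using Suc by linarith
  also have "\<dots> \<le> M (Suc n)" using m_ge_2[of n] by (simp add: M_Suc)
  finally show ?case .
qed (simp add: M_0)

lemma sum_M_le: "(\<Sum>s\<le>l. real (M s)) \<le> 2 * real (M l)"
proof (induction l)
  case (Suc l)
  have "2 * M l \<le> M (Suc l)" using m_ge_2[of l] by (simp add: M_Suc)
  then have "2 * real (M l) \<le> real (M (Suc l))"
    by (metis of_nat_le_iff of_nat_mult of_nat_numeral)
  then show ?case using Suc by simp
qed (simp add: M_0)

text \<open>Only indices up to the largest \<open>L\<close> with \<open>M L \<le> n\<close>
  contribute, and the \<open>M l\<close> grow geometrically. Consequently the coefficients in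
  \<open>norm_fej_le\<close> add up to order \<open>n\<close>, that is, to order 1 for the
  normalized Fejer kernel.\<close>

lemma sum_M_restrict_le: "(\<Sum>l<N. if M l \<le> n then real (M l) else 0) \<le> 2 * real n"
proof (cases "n = 0")
  case True
  then show ?thesis using M_pos by (auto intro!: sum_nonpos)
next
  case False
  define L where "L = Max {l. M l \<le> n}"
  have sub: "{l. M l \<le> n} \<subseteq> {..n}"
    using less_M by (auto intro: less_imp_le order.trans)
  have ne: "{l. M l \<le> n} \<noteq> {}"
    using False by (auto intro!: exI[of _ 0] simp: M_0)
  have fin: "finite {l. M l \<le> n}" using sub finite_subset by blast
  have L: "M L \<le> n" using Max_in[OF fin ne] by (simp add: L_def)
  have "(\<Sum>l<N. if M l \<le> n then real (M l) else 0) = (\<Sum>l\<in>{l. l < N \<and> M l \<le> n}. real (M l))"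
    by (rule sum.mono_neutral_cong_right) auto
  also have "\<dots> \<le> (\<Sum>l\<le>L. real (M l))"
    using fin by (intro sum_mono2) (auto simp: L_def)
  also have "\<dots> \<le> 2 * real (M L)" by (rule sum_M_le)
  finally show ?thesis using L by simp
qed

lemma vil_digit_eq_0: "n < M k \<Longrightarrow> vil_digit m n k = 0"
  by (simp add: vil_digit_def)

lemma mult_add_less_M:
  assumes "j < M l" "a < m l"
  shows "a * M l + j < M (Suc l)"
proof -
  have "a * M l + j < Suc a * M l" using assms(1) by simp
  also have "\<dots> \<le> m l * M l" using assms(2) by (intro mult_le_mono1) simp
  finally show ?thesis by (simp add: M_Suc mult.commute)
qed

lemma vil_digit_add:
  assumes "j < M l" "a < m l"
  shows "vil_digit m (a * M l + j) k = (if k < l then vil_digit m j k else if k = l then a else 0)"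
proof -
  consider "k < l" | "k = l" | "k > l" by linarith
  then show ?thesis
  proof cases
    case 1
    then obtain c where c: "M l = M (Suc k) * c" using M_dvd[of "Suc k" l] by auto
    have "(a * M l + j) div M k = (j + M k * (m k * (a * c))) div M k"
      by (simp add: c M_Suc ac_simps)
    also have "\<dots> = m k * (a * c) + j div M k"
      using M_pos[of k] by (intro div_mult_self2) simp
    finally show ?thesis using 1 by (simp add: vil_digit_def)
  next
    case 2
    then show ?thesis using assms M_pos[of l] by (simp add: vil_digit_def)
  next
    case 3
    have "a * M l + j < M (Suc l)" using assms by (rule mult_add_less_M)
    also have "\<dots> \<le> M k" using 3 by (intro M_mono) simp
    finally show ?thesis using 3 by (simp add: vil_digit_eq_0)
  qed
qed

text \<open>For \<open>\<theta> k = r\<^sub>k(x) / r\<^sub>k(t)\<close> the following are \<open>\<psi>\<^sub>n(x - t)\<close>, the Dirichlet kernel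
  \<open>D\<^sub>n(x - t)\<close>, and \<open>n\<close> times the Fejer kernel.\<close>

definition chr :: "(nat \<Rightarrow> complex) \<Rightarrow> nat \<Rightarrow> complex" where
  "chr \<theta> n = (\<Prod>k<n. \<theta> k ^ vil_digit m n k)"

definition dir :: "(nat \<Rightarrow> complex) \<Rightarrow> nat \<Rightarrow> complex" where
  "dir \<theta> n = (\<Sum>k<n. chr \<theta> k)"

definition fej :: "(nat \<Rightarrow> complex) \<Rightarrow> nat \<Rightarrow> complex" where
  "fej \<theta> n = (\<Sum>k<n. dir \<theta> k)"

text \<open>For \<open>s < l\<close> coordinate \<open>s\<close> is left free; for
  \<open>s \<ge> l\<close> none is, so \<open>near \<theta> l l\<close> means agreement in all
  coordinates below \<open>l\<close>.\<close>

definition near :: "(nat \<Rightarrow> complex) \<Rightarrow> nat \<Rightarrow> nat \<Rightarrow> bool" where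
  "near \<theta> l s \<longleftrightarrow> (\<forall>j<l. j \<noteq> s \<longrightarrow> \<theta> j = 1)"

text \<open>This is B_l of the overview when \<open>\<theta>\<close> is \<open>ratio x t\<close>. By
  \<open>dir_M\<close> the summand \<open>s = l\<close> is the Dirichlet kernel of index
  \<open>M l\<close>.\<close>

definition maj :: "(nat \<Rightarrow> complex) \<Rightarrow> nat \<Rightarrow> real" where
  "maj \<theta> l = (\<Sum>s\<le>l. real (M s) * of_bool (near \<theta> l s))"

lemma maj_nonneg: "maj \<theta> l \<ge> 0"
  by (simp add: maj_def sum_nonneg)

text \<open>The cutoff \<open>n\<close> in \<open>chr\<close> is generous: any \<open>N\<close> with
  \<open>n < M N\<close> already captures all nonzero digits, so numbers of different size can be
  compared over one range.\<close>

lemma chr_eq: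
  assumes "n < M N"
  shows "chr \<theta> n = (\<Prod>k<N. \<theta> k ^ vil_digit m n k)"
proof -
  have 0: "vil_digit m n k = 0" if "k \<ge> n \<or> k \<ge> N" for k
    using that less_M[of k] M_mono[of N k] assms by (intro vil_digit_eq_0) linarith
  have "chr \<theta> n = (\<Prod>k<max n N. \<theta> k ^ vil_digit m n k)"
    unfolding chr_def by (rule prod.mono_neutral_left) (auto simp: 0)
  also have "\<dots> = (\<Prod>k<N. \<theta> k ^ vil_digit m n k)"
    by (rule prod.mono_neutral_right) (auto simp: 0)
  finally show ?thesis .
qed

lemma chr_add:
  assumes "j < M l" "a < m l"
  shows "chr \<theta> (a * M l + j) = \<theta> l ^ a * chr \<theta> j"
proof -
  have "chr \<theta> (a * M l + j) = (\<Prod>k<Suc l. \<theta> k ^ vil_digit m (a * M l + j) k)"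
    using assms by (intro chr_eq mult_add_less_M)
  also have "\<dots> = (\<Prod>k<l. \<theta> k ^ vil_digit m j k) * \<theta> l ^ a"
    using assms by (simp add: vil_digit_add)
  finally show ?thesis using assms by (simp add: chr_eq mult.commute)
qed

lemma dir_add:
  assumes "j \<le> M l" "a < m l"
  shows "dir \<theta> (a * M l + j) = dir \<theta> (a * M l) + \<theta> l ^ a * dir \<theta> j"
  using assms(1)
proof (induction j)
  case (Suc j)
  then show ?case using assms(2) chr_add[of j l a \<theta>] by (simp add: dir_def algebra_simps)
qed (simp add: dir_def)

lemma dir_mult: "a \<le> m l \<Longrightarrow> dir \<theta> (a * M l) = (\<Sum>i<a. \<theta> l ^ i) * dir \<theta> (M l)"
proof (induction a)
  case (Suc a)
  have "dir \<theta> (Suc a * M l) = dir \<theta> (a * M l) + \<theta> l ^ a * dir \<theta> (M l)"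
    using dir_add[of "M l" l a] Suc.prems by (simp add: add.commute)
  then show ?case using Suc by (simp add: algebra_simps)
qed (simp add: dir_def)

text \<open>By \<open>dir_add\<close>, each of the \<open>j\<close> additional Dirichlet kernels
  consists of the common block \<open>dir \<theta> (a * M l)\<close> and a rotated kernel
  \<open>\<theta> l ^ a * dir \<theta> i\<close> with \<open>i < j\<close>.\<close>

lemma fej_add:
  assumes "j \<le> M l" "a < m l"
  shows "fej \<theta> (a * M l + j) = fej \<theta> (a * M l) + of_nat j * dir \<theta> (a * M l) + \<theta> l ^ a * fej \<theta> j"
  using assms(1)
proof (induction j)
  case (Suc j)
  then show ?case using assms(2) dir_add[of j l a \<theta>] by (simp add: fej_def algebra_simps)
qed (simp add: fej_def)

section \<open>Kernel bounds when every coordinate is a root of unity\<close>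

context
  fixes \<theta> :: "nat \<Rightarrow> complex"
  assumes norm_1: "\<And>k. norm (\<theta> k) = 1" and root: "\<And>k. \<theta> k ^ m k = 1"
begin

lemma geometric: "(\<Sum>i<m l. \<theta> l ^ i) = (if \<theta> l = 1 then of_nat (m l) else 0)"
  using root[of l] by (auto simp: sum_gp_strict)

text \<open>Paley's lemma: each coordinate below \<open>l\<close> contributes a full geometric sum,
  which vanishes unless that coordinate is 1.\<close>

lemma dir_M: "dir \<theta> (M l) = (if near \<theta> l l then of_nat (M l) else 0)"
proof (induction l)
  case 0
  then show ?case by (simp add: dir_def M_0 near_def chr_def)
next
  case (Suc l)
  have "dir \<theta> (M (Suc l)) = (if \<theta> l = 1 then of_nat (m l) else 0) * dir \<theta> (M l)"
    using dir_mult[of "m l" l \<theta>] geometric[of l] by (simp add: M_Suc mult.commute)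
  moreover have "near \<theta> (Suc l) (Suc l) \<longleftrightarrow> near \<theta> l l \<and> \<theta> l = 1"
    by (auto simp: near_def less_Suc_eq)
  ultimately show ?case using Suc by (auto simp: M_Suc mult.commute)
qed

lemma norm_dir_mult_le:
  assumes "a \<le> m l"
  shows "norm (dir \<theta> (a * M l)) \<le> real a * (real (M l) * of_bool (near \<theta> l l))"
proof -
  have "norm (\<Sum>i<a. \<theta> l ^ i) \<le> real a"
    by (rule sum_norm_bound[THEN order.trans]) (auto simp: norm_power norm_1)
  then show ?thesis using assms
    by (auto simp: dir_mult dir_M norm_mult intro!: mult_right_mono)
qed

text \<open>Here \<open>c\<close> collects the partial geometric sums with \<open>i < a\<close>
  terms, each of norm at most \<open>a\<close>, whence \<open>a ^ 2\<close>. The other geometric sum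
  is kept exact because for \<open>a = m l\<close> it vanishes unless
  \<open>\<theta> l = 1\<close>.\<close>

lemma fej_mult:
  assumes "a \<le> m l"
  obtains c where "fej \<theta> (a * M l) = c * (of_nat (M l) * dir \<theta> (M l)) + (\<Sum>i<a. \<theta> l ^ i) * fej \<theta> (M l)"
    "norm c \<le> real a ^ 2"
proof -
  have "\<exists>c. fej \<theta> (a * M l) = c * (of_nat (M l) * dir \<theta> (M l)) + (\<Sum>i<a. \<theta> l ^ i) * fej \<theta> (M l)
      \<and> norm c \<le> real a ^ 2"
    using assms
  proof (induction a)
    case 0
    then show ?case by (intro exI[of _ 0]) (simp add: fej_def)
  next
    case (Suc a)
    then obtain c where c: "fej \<theta> (a * M l) =
        c * (of_nat (M l) * dir \<theta> (M l)) + (\<Sum>i<a. \<theta> l ^ i) * fej \<theta> (M l)" "norm c \<le> real a ^ 2"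
      by auto
    define g where "g = (\<Sum>i<a. \<theta> l ^ i)"
    have g: "norm g \<le> real a" unfolding g_def
      by (rule sum_norm_bound[THEN order.trans]) (auto simp: norm_power norm_1)
    have "fej \<theta> (Suc a * M l) = fej \<theta> (a * M l) + of_nat (M l) * dir \<theta> (a * M l) + \<theta> l ^ a * fej \<theta> (M l)"
      using fej_add[of "M l" l a \<theta>] Suc.prems by (simp add: add.commute)
    also have "\<dots> = (c + g) * (of_nat (M l) * dir \<theta> (M l)) + (\<Sum>i<Suc a. \<theta> l ^ i) * fej \<theta> (M l)"
      using Suc.prems by (simp add: c(1) dir_mult g_def algebra_simps)
    finally have "fej \<theta> (Suc a * M l) =
      (c + g) * (of_nat (M l) * dir \<theta> (M l)) + (\<Sum>i<Suc a. \<theta> l ^ i) * fej \<theta> (M l)" .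
    moreover have "norm (c + g) \<le> real (Suc a) ^ 2"
      using norm_triangle_ineq[of c g] c(2) g by (simp add: power2_eq_square algebra_simps)
    ultimately show ?case by blast
  qed
  then show ?thesis using that by blast
qed

text \<open>From \<open>l\<close> to \<open>Suc l\<close> the Dirichlet block supplies the new
  summand \<open>s = l\<close>, while the old summands survive only if
  \<open>\<theta> l = 1\<close>, which is exactly the extra condition in
  \<open>near \<theta> (Suc l) s\<close>. The sum starts empty since \<open>M 0 = 1\<close> and
  \<open>fej \<theta> 1 = dir \<theta> 0 = 0\<close>.\<close>

lemma norm_fej_M_le:
  "norm (fej \<theta> (M l)) \<le> real b * real (M l) * (\<Sum>s<l. real (M s) * of_bool (near \<theta> l s))"
proof (induction l)
  case 0
  then show ?case by (simp add: fej_def dir_def M_0)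
next
  case (Suc l)
  obtain c where c: "fej \<theta> (m l * M l) =
      c * (of_nat (M l) * dir \<theta> (M l)) + (\<Sum>i<m l. \<theta> l ^ i) * fej \<theta> (M l)" "norm c \<le> real (m l) ^ 2"
    using fej_mult[of "m l" l] by auto
  have near_l: "near \<theta> (Suc l) l \<longleftrightarrow> near \<theta> l l"
    by (auto simp: near_def less_Suc_eq)
  have near_s: "near \<theta> (Suc l) s \<longleftrightarrow> near \<theta> l s" if "s < l" "\<theta> l = 1" for s
    using that by (auto simp: near_def less_Suc_eq)
  have "norm (c * (of_nat (M l) * dir \<theta> (M l))) \<le>
      real (m l) ^ 2 * (real (M l) * (real (M l) * of_bool (near \<theta> l l)))"
    using c(2) by (auto simp: norm_mult dir_M intro!: mult_right_mono)
  \<comment> \<open>One factor \<open>m l\<close> will be absorbed into \<open>M (Suc l)\<close>;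
    the other is estimated by \<open>b\<close>, which is where the constant of the lemma comes
    from.\<close>
  also have "\<dots> \<le> real b * real (m l) * (real (M l) * (real (M l) * of_bool (near \<theta> l l)))"
    using m_le[of l] by (intro mult_right_mono) (auto simp: power2_eq_square intro!: mult_right_mono)
  also have "\<dots> = real b * real (M (Suc l)) * (real (M l) * of_bool (near \<theta> (Suc l) l))"
    by (simp add: M_Suc near_l)
  finally have 1: "norm (c * (of_nat (M l) * dir \<theta> (M l))) \<le>
      real b * real (M (Suc l)) * (real (M l) * of_bool (near \<theta> (Suc l) l))" .
  have 2: "norm ((\<Sum>i<m l. \<theta> l ^ i) * fej \<theta> (M l)) \<le>
      real b * real (M (Suc l)) * (\<Sum>s<l. real (M s) * of_bool (near \<theta> (Suc l) s))"
  proof (cases "\<theta> l = 1")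
    case True
    have "norm ((\<Sum>i<m l. \<theta> l ^ i) * fej \<theta> (M l)) = real (m l) * norm (fej \<theta> (M l))"
      using True by (simp add: geometric norm_mult)
    also have "\<dots> \<le> real (m l) * (real b * real (M l) * (\<Sum>s<l. real (M s) * of_bool (near \<theta> l s)))"
      using Suc by (intro mult_left_mono) auto
    also have "\<dots> = real b * real (M (Suc l)) * (\<Sum>s<l. real (M s) * of_bool (near \<theta> (Suc l) s))"
      using True by (simp add: M_Suc near_s)
    finally show ?thesis .
  next
    case False
    then show ?thesis unfolding geometric by (simp add: sum_nonneg)
  qed
  have "norm (fej \<theta> (M (Suc l))) \<le>
      norm (c * (of_nat (M l) * dir \<theta> (M l))) + norm ((\<Sum>i<m l. \<theta> l ^ i) * fej \<theta> (M l))"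
    using c(1) norm_triangle_ineq by (simp add: M_Suc mult.commute)
  also have "\<dots> \<le> real b * real (M (Suc l)) * (\<Sum>s<Suc l. real (M s) * of_bool (near \<theta> (Suc l) s))"
    using 1 2 by (simp add: algebra_simps)
  finally show ?case .
qed

lemma norm_fej_mult_le:
  assumes "a \<le> m l"
  shows "norm (fej \<theta> (a * M l)) \<le> real b ^ 2 * real (M l) * maj \<theta> l"
proof -
  obtain c where c: "fej \<theta> (a * M l) =
      c * (of_nat (M l) * dir \<theta> (M l)) + (\<Sum>i<a. \<theta> l ^ i) * fej \<theta> (M l)" "norm c \<le> real a ^ 2"
    using fej_mult[OF assms] by blast
  have ab: "real a \<le> real b" using assms m_le[of l] by simp
  have g: "norm (\<Sum>i<a. \<theta> l ^ i) \<le> real b"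
    by (rule sum_norm_bound[THEN order.trans]) (use ab in \<open>auto simp: norm_power norm_1\<close>)
  have cb: "norm c \<le> real b ^ 2"
    using c(2) power_mono[OF ab, of 2] by linarith
  have "norm (fej \<theta> (a * M l)) \<le> norm c * (real (M l) * norm (dir \<theta> (M l)))
      + norm (\<Sum>i<a. \<theta> l ^ i) * norm (fej \<theta> (M l))"
    unfolding c(1) by (rule norm_triangle_le) (simp add: norm_mult)
  also have "\<dots> \<le> real b ^ 2 * (real (M l) * (real (M l) * of_bool (near \<theta> l l)))
      + real b * (real b * real (M l) * (\<Sum>s<l. real (M s) * of_bool (near \<theta> l s)))"
    by (intro add_mono mult_mono cb g norm_fej_M_le) (auto simp: dir_M intro!: mult_nonneg_nonneg)
  also have "\<dots> = real b ^ 2 * real (M l) * maj \<theta> l"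
    by (simp add: maj_def lessThan_Suc_atMost[symmetric] algebra_simps power2_eq_square)
  finally show ?thesis .
qed

lemma norm_fej_le:
  assumes "n < M N"
  shows "norm (fej \<theta> n) \<le> 2 * real b ^ 2 * (\<Sum>l<N. if M l \<le> n then real (M l) * maj \<theta> l else 0)"
  using assms
proof (induction N arbitrary: n)
  case 0
  then show ?case by (simp add: M_0 fej_def)
next
  case (Suc N)
  show ?case
  proof (cases "n < M N")
    case True
    then show ?thesis using Suc.IH[OF True] by simp
  next
    case False
    define a j where "a = n div M N" and "j = n mod M N"
    have n: "n = a * M N + j" unfolding a_def j_def by (rule div_mult_mod_eq[symmetric])
    have j: "j < M N" using M_pos by (simp add: j_def)
    have a: "a < m N" using Suc.prems
      by (simp add: a_def M_Suc less_mult_imp_div_less mult.commute)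
    have b0: "real b \<ge> 2" using b_ge_2 by simp
    have "norm (fej \<theta> n) \<le> norm (fej \<theta> (a * M N)) + norm (of_nat j * dir \<theta> (a * M N)) + norm (\<theta> N ^ a * fej \<theta> j)"
      unfolding n using j a by (simp only: fej_add less_imp_le) (intro norm_triangle_mono norm_triangle_ineq order_refl)
    also have "norm (\<theta> N ^ a * fej \<theta> j) = norm (fej \<theta> j)"
      by (simp add: norm_mult norm_power norm_1)
    also have "norm (of_nat j * dir \<theta> (a * M N)) \<le> real (M N) * (real b * maj \<theta> N)"
    proof -
      have "norm (dir \<theta> (a * M N)) \<le> real a * (real (M N) * of_bool (near \<theta> N N))"
        using a by (intro norm_dir_mult_le) simp
      also have "\<dots> \<le> real b * maj \<theta> N"
      proof (intro mult_mono)
        show "real (M N) * of_bool (near \<theta> N N) \<le> maj \<theta> N"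
          unfolding maj_def by (intro member_le_sum) auto
      qed (use a m_le[of N] in auto)
      finally show ?thesis using j by (auto simp: norm_mult intro!: mult_mono maj_nonneg)
    qed
    also have "real (M N) * (real b * maj \<theta> N) \<le> real b ^ 2 * real (M N) * maj \<theta> N"
    proof -
      have "real b * (real (M N) * maj \<theta> N) \<le> real b ^ 2 * (real (M N) * maj \<theta> N)"
        using b0 by (intro mult_right_mono) (auto simp: power2_eq_square maj_nonneg)
      then show ?thesis by (simp add: mult_ac)
    qed
    also have "norm (fej \<theta> (a * M N)) \<le> real b ^ 2 * real (M N) * maj \<theta> N"
      using a by (intro norm_fej_mult_le) simp
    also have "norm (fej \<theta> j) \<le> 2 * real b ^ 2 * (\<Sum>l<N. if M l \<le> n then real (M l) * maj \<theta> l else 0)"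
      using n by (intro Suc.IH[OF j, THEN order.trans] mult_left_mono sum_mono) (auto simp: maj_nonneg)
    finally show ?thesis using False by (simp add: algebra_simps)
  qed
qed

end

end

subsection \<open>Integration on the Vilenkin group\<close>

lemma cnj_measurable [measurable]: "cnj \<in> borel_measurable borel"
  by (intro borel_measurable_continuous_onI continuous_intros)

context bounded_vilenkin
begin

abbreviation \<mu> :: "(nat \<Rightarrow> int) measure" where "\<mu> \<equiv> vil_measure m"
abbreviation G :: "(nat \<Rightarrow> int) set" where "G \<equiv> carrier (vil_group m)"

lemma carrier_Z: "carrier (vil_Z m k) = {0..<int (m k)}"
  using m_pos[of k] by (simp add: carrier_integer_mod_group)

lemma in_G: "x \<in> G \<longleftrightarrow> (\<forall>k. 0 \<le> x k \<and> x k < int (m k))"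
  by (simp add: vil_group_def carrier_Z PiE_iff)

lemma space_\<mu>: "space \<mu> = G"
  by (simp add: vil_measure_def vil_group_def space_PiM space_uniform_count_measure)

lemma product_prob_space_\<mu>:
  "product_prob_space (\<lambda>k. uniform_count_measure (carrier (vil_Z m k)))"
proof -
  have "prob_space (uniform_count_measure (carrier (vil_Z m k)))" for k
    using m_pos[of k] by (intro prob_space_uniform_count_measure) (auto simp: carrier_Z)
  then show ?thesis
    unfolding product_prob_space_def product_prob_space_axioms_def product_sigma_finite_def
    by (auto intro: prob_space_imp_sigma_finite)
qed

sublocale V: prob_space \<mu>
proof -
  interpret P: product_prob_space "\<lambda>k. uniform_count_measure (carrier (vil_Z m k))" UNIV
    by (rule product_prob_space_\<mu>)
  show "prob_space \<mu>"
    unfolding vil_measure_def by (rule P.P.prob_space_axioms)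
qed

sublocale VV: pair_sigma_finite \<mu> \<mu> ..

lemma coordinate_measurable [measurable]: "(\<lambda>x. x k) \<in> measurable \<mu> (count_space UNIV)"
proof -
  have "(\<lambda>x. x k) \<in> measurable \<mu> (uniform_count_measure (carrier (vil_Z m k)))"
    unfolding vil_measure_def by (rule measurable_component_singleton) simp
  moreover have "(\<lambda>x. x) \<in> measurable (uniform_count_measure (carrier (vil_Z m k))) (count_space UNIV)"
    by (auto simp: measurable_def sets_uniform_count_measure space_uniform_count_measure)
  ultimately show ?thesis by (rule measurable_compose)
qed

lemma rad_measurable [measurable]: "vil_rad m k \<in> borel_measurable \<mu>"
proof -
  have "(\<lambda>x. (\<lambda>i. exp (2 * of_real pi * \<i> * of_int i / of_nat (m k)) :: complex) (x k)) \<in> borel_measurable \<mu>"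
    by (rule measurable_compose[OF coordinate_measurable]) simp
  then show ?thesis unfolding vil_rad_def .
qed

lemma psi_eq: "vil_psi m n x = (\<Prod>k<n. vil_rad m k x ^ vil_digit m n k)"
  unfolding vil_psi_def
proof (rule prodinf_finite)
  fix k assume "k \<notin> {..<n}"
  then have "n < M k" using less_M[of k] by auto
  then show "vil_rad m k x ^ vil_digit m n k = 1" by (simp add: vil_digit_eq_0)
qed simp

lemma psi_measurable [measurable]: "vil_psi m n \<in> borel_measurable \<mu>"
  unfolding psi_eq by measurable

lemma rad_cis: "vil_rad m k x = cis (2 * pi * of_int (x k) / real (m k))"
  by (simp add: vil_rad_def cis_conv_exp mult_ac)

lemma norm_rad: "norm (vil_rad m k x) = 1"
  by (simp add: rad_cis)

lemma norm_psi: "norm (vil_psi m n x) = 1"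
  by (simp add: psi_eq prod_norm[symmetric] norm_power norm_rad)

lemma rad_power: "vil_rad m k x ^ m k = 1"
proof -
  have "vil_rad m k x ^ m k = cis (real (m k) * (2 * pi * of_int (x k) / real (m k)))"
    unfolding rad_cis by (rule Complex.DeMoivre)
  also have "real (m k) * (2 * pi * of_int (x k) / real (m k)) = 2 * pi * of_int (x k)"
    using m_pos[of k] by simp
  finally show ?thesis by (simp add: cis_multiple_2pi)
qed

text \<open>This is r_k(x - t), written without group subtraction: it is jointly measurable in the
  two points, and exchanging them conjugates it.\<close>

definition ratio :: "(nat \<Rightarrow> int) \<Rightarrow> (nat \<Rightarrow> int) \<Rightarrow> nat \<Rightarrow> complex" where
  "ratio x t k = vil_rad m k x * cnj (vil_rad m k t)"

lemma norm_ratio: "norm (ratio x t k) = 1"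
  by (simp add: ratio_def norm_mult norm_rad)

lemma ratio_power: "ratio x t k ^ m k = 1"
  by (simp add: ratio_def power_mult_distrib rad_power flip: complex_cnj_power)

lemma ratio_measurable [measurable]: "(\<lambda>p. ratio (fst p) (snd p) k) \<in> borel_measurable (\<mu> \<Otimes>\<^sub>M \<mu>)"
  unfolding ratio_def by measurable

text \<open>A ratio of 1 makes \<open>m k\<close> divide \<open>x k - t k\<close>, whose absolute
  value is below \<open>m k\<close>.\<close>

lemma ratio_eq_1_iff:
  assumes "x \<in> G" "t \<in> G"
  shows "ratio x t k = 1 \<longleftrightarrow> x k = t k"
proof
  assume "ratio x t k = 1"
  then have "cis (2 * pi * real_of_int (x k - t k) / real (m k)) = 1"
    by (simp add: ratio_def rad_cis cis_cnj cis_mult diff_divide_distrib[symmetric] algebra_simps)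
  then have "cos (2 * pi * real_of_int (x k - t k) / real (m k)) = 1"
    by (metis cis.simps(1) one_complex.simps(1))
  then obtain n :: int where "2 * pi * real_of_int (x k - t k) / real (m k) = of_int n * 2 * pi"
    by (auto simp: cos_one_2pi_int)
  then have "2 * pi * real_of_int (x k - t k) = 2 * pi * real_of_int (n * int (m k))"
    using m_pos[of k] by (simp add: field_simps)
  then have "real_of_int (x k - t k) = real_of_int (n * int (m k))"
    by (subst (asm) mult_cancel_left) simp
  then have *: "x k - t k = n * int (m k)" by linarith
  have "\<bar>x k - t k\<bar> < int (m k)" using assms unfolding in_G by (smt (verit))
  then have "\<bar>n\<bar> * int (m k) < 1 * int (m k)" unfolding * by (simp add: abs_mult)
  then have "n = 0" using m_pos[of k] by (simp only: mult_less_cancel_right) linarith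
  then show "x k = t k" using * by simp
next
  assume "x k = t k"
  then have "vil_rad m k t = vil_rad m k x" by (simp add: vil_rad_def)
  then show "ratio x t k = 1"
    by (simp add: ratio_def complex_norm_square[symmetric] norm_rad)
qed

lemma ratio_commute: "ratio t x k = cnj (ratio x t k)"
  by (simp add: ratio_def)

lemma chr_ratio: "chr (ratio x t) n = vil_psi m n x * cnj (vil_psi m n t)"
  by (simp add: chr_def ratio_def psi_eq power_mult_distrib prod.distrib)

text \<open>For \<open>x\<close> in \<open>G\<close> and \<open>s < l\<close> this is the union of
  I_l(x - r e_s) over all residues r, including r = 0; for \<open>s \<ge> l\<close> it is
  I_l(x).\<close>

definition cyl :: "nat \<Rightarrow> nat \<Rightarrow> (nat \<Rightarrow> int) \<Rightarrow> (nat \<Rightarrow> int) set" where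
  "cyl l s x = {t \<in> G. \<forall>j<l. j \<noteq> s \<longrightarrow> t j = x j}"

lemma vil_I_eq_cyl: "vil_I m l x = cyl l l x"
  by (auto simp: vil_I_def cyl_def)

lemma near_ratio:
  assumes "x \<in> G" "t \<in> G"
  shows "near (ratio x t) l s \<longleftrightarrow> t \<in> cyl l s x"
  using assms by (auto simp: near_def cyl_def ratio_eq_1_iff)

lemma cyl_sets [measurable]: "cyl l s x \<in> sets \<mu>"
proof -
  have "cyl l s x = {t \<in> space \<mu>. \<forall>j<l. j \<noteq> s \<longrightarrow> t j = x j}"
    by (auto simp: cyl_def space_\<mu>)
  also have "\<dots> \<in> sets \<mu>" by measurable
  finally show ?thesis .
qed

lemma measure_cyl:
  assumes "x \<in> G"
  shows "measure \<mu> (cyl l s x) = 1 / real (\<Prod>j\<in>{..<l} - {s}. m j)"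
proof -
  interpret P: product_prob_space "\<lambda>k. uniform_count_measure (carrier (vil_Z m k))" UNIV
    by (rule product_prob_space_\<mu>)
  have "cyl l s x = prod_emb UNIV (\<lambda>k. uniform_count_measure (carrier (vil_Z m k))) ({..<l} - {s})
      (\<Pi>\<^sub>E j\<in>{..<l} - {s}. {x j})"
    by (auto simp: cyl_def prod_emb_def vil_group_def space_uniform_count_measure PiE_iff)
  then have "measure \<mu> (cyl l s x) =
      (\<Prod>j\<in>{..<l} - {s}. measure (uniform_count_measure (carrier (vil_Z m j))) {x j})"
    using assms unfolding vil_measure_def
    by (simp only:) (rule P.measure_PiM_emb, auto simp: sets_uniform_count_measure carrier_Z in_G)
  also have "\<dots> = (\<Prod>j\<in>{..<l} - {s}. 1 / real (m j))"
    using assms by (intro prod.cong) (auto simp: measure_uniform_count_measure carrier_Z in_G)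
  finally show ?thesis by (simp add: prod_dividef)
qed

text \<open>Freeing coordinate \<open>s < l\<close> multiplies the measure 1/M_l of I_l(x) by
  \<open>m s\<close>, which is at most \<open>b\<close>.\<close>

lemma measure_cyl_le:
  assumes "x \<in> G"
  shows "measure \<mu> (cyl l s x) \<le> real b / real (M l)"
proof -
  define p where "p = (\<Prod>j\<in>{..<l} - {s}. m j)"
  have "M l \<le> b * p"
  proof (cases "s < l")
    case True
    then have "M l = m s * p" by (simp add: vil_M_def p_def prod.remove)
    then show ?thesis using m_le[of s] by simp
  next
    case False
    then have "{..<l} - {s} = {..<l}" by auto
    then have "M l = p" by (simp add: vil_M_def p_def)
    then show ?thesis using b_ge_2 by simp
  qed
  then have "real (M l) \<le> real b * real p" by (metis of_nat_le_iff of_nat_mult)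
  moreover have "p > 0" using m_pos by (simp add: p_def)
  ultimately show ?thesis using M_pos[of l]
    by (simp add: measure_cyl[OF assms] p_def[symmetric] divide_simps mult.commute)
qed

lemma maj_measurable [measurable]:
  "(\<lambda>p. maj (ratio (fst p) (snd p)) l) \<in> borel_measurable (\<mu> \<Otimes>\<^sub>M \<mu>)"
proof -
  have [measurable]: "Measurable.pred (\<mu> \<Otimes>\<^sub>M \<mu>) (\<lambda>p. near (ratio (fst p) (snd p)) l s)" for s
    unfolding near_def by measurable
  show ?thesis unfolding maj_def of_bool_def by measurable
qed

lemma maj_measurable_2: "x \<in> G \<Longrightarrow> (\<lambda>t. maj (ratio x t) l) \<in> borel_measurable \<mu>"
  using measurable_compose[OF measurable_Pair1' maj_measurable, of x l] by (simp add: space_\<mu>)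

text \<open>This symmetry gives the kernel bound the same integral estimate in either variable, as
  needed after Fubini.\<close>

lemma maj_commute: "maj (ratio x t) l = maj (ratio t x) l"
proof -
  have "ratio t x j = 1 \<longleftrightarrow> ratio x t j = 1" for j
    by (metis ratio_commute complex_cnj_one complex_cnj_cnj)
  then show ?thesis by (simp add: maj_def near_def)
qed

lemma maj_ratio:
  assumes "x \<in> G" "t \<in> G"
  shows "maj (ratio x t) l = (\<Sum>s\<le>l. real (M s) * indicator (cyl l s x) t)"
  by (simp add: maj_def near_ratio[OF assms] indicator_def of_bool_def)

lemma maj_le: "maj \<theta> l \<le> 2 * real (M l)"
proof -
  have "maj \<theta> l \<le> (\<Sum>s\<le>l. real (M s))"
    unfolding maj_def by (intro sum_mono) simp
  then show ?thesis using sum_M_le[of l] by simp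
qed

lemma integrable_maj: "x \<in> G \<Longrightarrow> integrable \<mu> (\<lambda>t. maj (ratio x t) l)"
  by (rule V.integrable_const_bound[where B = "2 * real (M l)"])
     (auto simp: maj_measurable_2 maj_le maj_nonneg)

lemma integral_maj_le:
  assumes "x \<in> G"
  shows "(\<integral>t. maj (ratio x t) l \<partial>\<mu>) \<le> 2 * real b"
proof -
  have "(\<integral>t. maj (ratio x t) l \<partial>\<mu>) = (\<integral>t. (\<Sum>s\<le>l. real (M s) * indicator (cyl l s x) t) \<partial>\<mu>)"
    by (intro Bochner_Integration.integral_cong) (auto simp: maj_ratio[OF assms] space_\<mu>)
  also have "\<dots> = (\<Sum>s\<le>l. real (M s) * measure \<mu> (cyl l s x))"
    by (subst Bochner_Integration.integral_sum) (auto simp: V.emeasure_eq_measure)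
  also have "\<dots> \<le> (\<Sum>s\<le>l. real (M s) * (real b / real (M l)))"
    by (intro sum_mono mult_left_mono measure_cyl_le assms) auto
  also have "\<dots> = (\<Sum>s\<le>l. real (M s)) * (real b / real (M l))"
    by (rule sum_distrib_right[symmetric])
  also have "\<dots> \<le> 2 * real (M l) * (real b / real (M l))"
    by (intro mult_right_mono sum_M_le) auto
  also have "\<dots> = 2 * real b" using M_pos[of l] by simp
  finally show ?thesis .
qed

text \<open>The character depends on the first \<open>n\<close> coordinates only, so its integral
  factors over them. A positive \<open>n\<close> has a nonzero digit, and its factor is the average
  of all powers \<open>w ^ i\<close> of a root of unity \<open>w\<close> different from 1.\<close>

lemma integral_psi:
  assumes "n > 0"
  shows "(\<integral>t. vil_psi m n t \<partial>\<mu>) = 0"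
proof -
  interpret P: product_prob_space "\<lambda>k. uniform_count_measure (carrier (vil_Z m k))" UNIV
    by (rule product_prob_space_\<mu>)
  define g :: "nat \<Rightarrow> int \<Rightarrow> complex" where
    "g k i = exp (2 * of_real pi * \<i> * of_int i / of_nat (m k)) ^ vil_digit m n k" for k i
  have fin: "finite (carrier (vil_Z m k))" for k by (simp add: carrier_Z)
  have g_int: "integral\<^sup>L (uniform_count_measure (carrier (vil_Z m k))) (g k) = (\<Sum>i<m k. g k (int i)) / of_nat (m k)"
    for k
  proof -
    have "integral\<^sup>L (uniform_count_measure (carrier (vil_Z m k))) (g k) =
        (\<Sum>i\<in>carrier (vil_Z m k). (1 / real (card (carrier (vil_Z m k)))) *\<^sub>R g k i)"
      unfolding uniform_count_measure_def
      by (subst lebesgue_integral_point_measure_finite) (auto simp: fin)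
    also have "\<dots> = (\<Sum>i<m k. (1 / real (m k)) *\<^sub>R g k (int i))"
      by (rule sum.reindex_bij_witness[where i = int and j = nat]) (auto simp: carrier_Z)
    finally show ?thesis by (simp add: scaleR_conv_of_real sum_divide_distrib)
  qed
  have g_meas: "(\<lambda>t. \<Prod>k<n. g k (t k)) \<in>
      borel_measurable (PiM {..<n} (\<lambda>k. uniform_count_measure (carrier (vil_Z m k))))"
  proof (intro borel_measurable_prod)
    fix k assume k: "k \<in> {..<n}"
    have "g k \<in> borel_measurable (uniform_count_measure (carrier (vil_Z m k)))"
      by (simp add: uniform_count_measure_def)
    then show "(\<lambda>t. g k (t k)) \<in>
        borel_measurable (PiM {..<n} (\<lambda>k. uniform_count_measure (carrier (vil_Z m k))))"
      by (rule measurable_compose[OF measurable_component_singleton[OF k]])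
  qed
  \<comment> \<open>The restriction changes no value; it exhibits the integrand as a function of the
    projection to finitely many coordinates, whose distribution is the finite product
    measure.\<close>
  have "(\<integral>t. vil_psi m n t \<partial>\<mu>) = (\<integral>t. (\<Prod>k<n. g k (restrict t {..<n} k)) \<partial>\<mu>)"
    by (simp add: psi_eq vil_rad_def g_def)
  also have "\<dots> = (\<integral>t. (\<Prod>k<n. g k (t k)) \<partial>PiM {..<n} (\<lambda>k. uniform_count_measure (carrier (vil_Z m k))))"
    unfolding vil_measure_def
    by (subst P.distr_PiM_restrict_finite[symmetric, of "{..<n}"], simp, simp,
        subst integral_distr) (auto intro!: measurable_restrict_subset g_meas)
  also have "\<dots> = (\<Prod>k<n. integral\<^sup>L (uniform_count_measure (carrier (vil_Z m k))) (g k))"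
    by (rule P.product_integral_prod)
       (auto simp: fin uniform_count_measure_def intro!: integrable_point_measure_finite)
  also have "\<dots> = 0"
  proof -
    have "\<exists>k<n. vil_digit m n k \<noteq> 0"
    proof (rule ccontr)
      assume *: "\<not> (\<exists>k<n. vil_digit m n k \<noteq> 0)"
      have "n = (\<Sum>j<n. vil_digit m n j * M j)"
        by (rule vil_digit_expansion(1)) (rule m_ge_2)
      also have "\<dots> = 0" using * by (intro sum.neutral) auto
      finally show False using assms by simp
    qed
    then obtain k where k: "k < n" "vil_digit m n k \<noteq> 0" by blast
    define d where "d = vil_digit m n k"
    define w where "w = cis (2 * pi * real d / real (m k))"
    have d: "0 < d" "d < m k" using k m_ge_2[of k] by (auto simp: d_def vil_digit_less)
    have "w \<noteq> 1"
    proof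
      assume "w = 1"
      then have "cos (2 * pi * real d / real (m k)) = 1"
        by (metis cis.simps(1) one_complex.simps(1) w_def)
      then obtain i :: int where "2 * pi * real d / real (m k) = of_int i * 2 * pi"
        by (auto simp: cos_one_2pi_int)
      then have "2 * pi * real_of_int (int d) = 2 * pi * real_of_int (i * int (m k))"
        using m_pos[of k] by (simp add: field_simps)
      then have "real_of_int (int d) = real_of_int (i * int (m k))"
        by (subst (asm) mult_cancel_left) simp
      then have "int d = i * int (m k)" by linarith
      then have "m k dvd d" by (metis dvd_triv_right int_dvd_int_iff)
      then show False using d dvd_imp_le by force
    qed
    moreover have "w ^ m k = 1"
    proof -
      have "w ^ m k = cis (real (m k) * (2 * pi * real d / real (m k)))"
        unfolding w_def by (rule Complex.DeMoivre)
      also have "real (m k) * (2 * pi * real d / real (m k)) = 2 * pi * real d"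
        using m_pos[of k] by simp
      finally show ?thesis by (simp add: cis_multiple_2pi)
    qed
    ultimately have "(\<Sum>i<m k. w ^ i) = 0" by (simp add: sum_gp_strict)
    moreover have "g k (int i) = w ^ i" for i
      by (simp add: g_def w_def d_def cis_conv_exp exp_of_nat_mult[symmetric] mult_ac)
    ultimately have "integral\<^sup>L (uniform_count_measure (carrier (vil_Z m k))) (g k) = 0"
      by (simp add: g_int)
    then show ?thesis using k(1) by (intro prod_zero) auto
  qed
  finally show ?thesis .
qed

end

subsection \<open>Mean deviations at a point\<close>

lemma integrable_times_bounded:
  fixes f g :: "'a \<Rightarrow> 'b::{real_normed_field, banach, second_countable_topology}"
  assumes f: "integrable M f" and g [measurable]: "g \<in> borel_measurable M"
    and bound: "\<And>x. norm (g x) \<le> B"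
  shows "integrable M (\<lambda>x. f x * g x)"
proof (rule Bochner_Integration.integrable_bound)
  show "integrable M (\<lambda>x. B *\<^sub>R f x)" using f by simp
  show "(\<lambda>x. f x * g x) \<in> borel_measurable M" using f by measurable
  show "AE x in M. norm (f x * g x) \<le> norm (B *\<^sub>R f x)"
  proof (intro AE_I2)
    fix x
    have "norm (g x) * norm (f x) \<le> \<bar>B\<bar> * norm (f x)"
      using bound[of x] by (intro mult_right_mono) auto
    then show "norm (f x * g x) \<le> norm (B *\<^sub>R f x)" by (simp add: norm_mult mult.commute)
  qed
qed

text \<open>The intersection of the sets is null, so off a null set the integrand is eventually 0;
  \<open>norm (g t)\<close> dominates.\<close>

lemma integral_indicator_decseq_tendsto_0:
  fixes g :: "'a \<Rightarrow> real"
  assumes g: "integrable M g" and A [measurable]: "\<And>n. A n \<in> sets M" and dec: "decseq A"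
    and lim: "(\<lambda>n. emeasure M (A n)) \<longlonglongrightarrow> 0"
  shows "(\<lambda>n. \<integral>t. g t * indicator (A n) t \<partial>M) \<longlonglongrightarrow> 0"
proof -
  have "emeasure M (\<Inter>n. A n) \<le> emeasure M (A n)" for n
    by (intro emeasure_mono) auto
  then have "emeasure M (\<Inter>n. A n) \<le> 0"
    by (intro tendsto_lowerbound[OF lim]) auto
  then have null: "(\<Inter>n. A n) \<in> null_sets M" by (auto intro: null_setsI)
  have "(\<lambda>n. \<integral>t. g t * indicator (A n) t \<partial>M) \<longlonglongrightarrow> (\<integral>t. 0 \<partial>M)"
  proof (rule integral_dominated_convergence)
    show "integrable M (\<lambda>t. norm (g t))" using g by simp
    show "AE t in M. (\<lambda>n. g t * indicator (A n) t) \<longlonglongrightarrow> 0"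
      using AE_not_in[OF null]
    proof eventually_elim
      case (elim t)
      then obtain k where k: "t \<notin> A k" by auto
      have "g t * indicator (A n) t = 0" if "n \<ge> k" for n
        using k decseqD[OF dec that] by (auto simp: indicator_def)
      then show ?case by (intro tendsto_eventually eventually_sequentiallyI[of k])
    qed
  qed (use g in \<open>auto simp: indicator_def\<close>)
  then show ?thesis by simp
qed

text \<open>Toeplitz's theorem for null sequences: finitely many columns vanish one by one, and past
  them the bounded row sums multiply small values of \<open>a\<close>.\<close>

lemma summation_matrix_tendsto_0:
  fixes \<rho> :: "nat \<Rightarrow> nat \<Rightarrow> real"
  assumes nonneg: "\<And>n l. \<rho> n l \<ge> 0" and sum: "\<And>n. (\<Sum>l<N n. \<rho> n l) \<le> C"
    and col: "\<And>l. (\<lambda>n. \<rho> n l) \<longlonglongrightarrow> 0" and a: "a \<longlonglongrightarrow> 0" "\<And>l. a l \<ge> 0"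
  shows "(\<lambda>n. \<Sum>l<N n. \<rho> n l * a l) \<longlonglongrightarrow> 0"
proof (rule LIMSEQ_I)
  fix e :: real assume e: "e > 0"
  have C: "C \<ge> 0" using sum[of 0] nonneg by (meson order.trans sum_nonneg)
  \<comment> \<open>The tail of a row costs at most \<open>d * C\<close>, which this choice keeps
    below \<open>e / 2\<close>; adding 1 covers \<open>C = 0\<close>.\<close>
  define d where "d = e / (2 * (C + 1))"
  have d: "d > 0" using e C by (simp add: d_def)
  have "d * C < d * (C + 1)" using d by simp
  also have "d * (C + 1) = e / 2" using C by (simp add: d_def divide_simps)
  finally have dC: "d * C < e / 2" .
  obtain L where L: "\<And>l. l \<ge> L \<Longrightarrow> norm (a l - 0) < d"
    using LIMSEQ_D[OF a(1) d] by blast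
  have "(\<lambda>n. \<Sum>l<L. \<rho> n l * a l) \<longlonglongrightarrow> (\<Sum>l<L. 0 * a l)"
    by (intro tendsto_intros col)
  then obtain n0 where n0: "\<And>n. n \<ge> n0 \<Longrightarrow> norm ((\<Sum>l<L. \<rho> n l * a l) - 0) < e / 2"
    using LIMSEQ_D[of _ 0 "e / 2"] e by fastforce
  have "norm ((\<Sum>l<N n. \<rho> n l * a l) - 0) < e" if "n \<ge> n0" for n
  proof -
    have "(\<Sum>l<N n. \<rho> n l * a l) \<le> (\<Sum>l<N n. \<rho> n l * a l * of_bool (l < L) + \<rho> n l * d)"
    proof (intro sum_mono)
      fix l
      show "\<rho> n l * a l \<le> \<rho> n l * a l * of_bool (l < L) + \<rho> n l * d"
        using L[of l] nonneg[of n l] d a(2)[of l] by (cases "l < L") (auto intro: mult_left_mono)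
    qed
    also have "\<dots> = (\<Sum>l<N n. \<rho> n l * a l * of_bool (l < L)) + (\<Sum>l<N n. \<rho> n l) * d"
      by (simp add: sum.distrib sum_distrib_right)
    also have "(\<Sum>l<N n. \<rho> n l) * d \<le> d * C"
      using mult_left_mono[OF sum[of n], of d] d by (simp add: mult.commute)
    also have "(\<Sum>l<N n. \<rho> n l * a l * of_bool (l < L)) \<le> (\<Sum>l<L. \<rho> n l * a l)"
    proof -
      have "(\<Sum>l<N n. \<rho> n l * a l * of_bool (l < L)) = (\<Sum>l\<in>{..<N n} \<inter> {..<L}. \<rho> n l * a l)"
        by (rule sum.mono_neutral_cong_right) auto
      also have "\<dots> \<le> (\<Sum>l<L. \<rho> n l * a l)"
        by (intro sum_mono2) (auto simp: nonneg a(2))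
      finally show ?thesis .
    qed
    finally have "(\<Sum>l<N n. \<rho> n l * a l) < e" using n0[OF that] dC by simp
    moreover have "(\<Sum>l<N n. \<rho> n l * a l) \<ge> 0" by (intro sum_nonneg mult_nonneg_nonneg nonneg a(2))
    ultimately show ?thesis by simp
  qed
  then show "\<exists>n0. \<forall>n\<ge>n0. norm ((\<Sum>l<N n. \<rho> n l * a l) - 0) < e" by blast
qed

context bounded_vilenkin
begin

lemma Lp_1_iff: "f \<in> vil_Lp m 1 \<longleftrightarrow> integrable \<mu> f"
  by (auto simp: vil_Lp_def powr_one integrable_norm_iff)

lemma tendsto_inverse_M: "(\<lambda>l. c / real (M l)) \<longlonglongrightarrow> 0"
proof (rule tendsto_divide_0[OF tendsto_const])
  have "filterlim (\<lambda>l. real (M l)) at_top sequentially"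
    by (rule filterlim_at_top_mono[OF filterlim_real_sequentially])
       (auto intro!: always_eventually less_imp_le less_M)
  then show "filterlim (\<lambda>l. real (M l)) at_infinity sequentially"
    by (rule filterlim_at_top_imp_at_infinity)
qed

definition deviation :: "((nat \<Rightarrow> int) \<Rightarrow> complex) \<Rightarrow> (nat \<Rightarrow> int) \<Rightarrow> nat \<Rightarrow> real" where
  "deviation f x l = (\<integral>t. norm (f t - f x) * maj (ratio x t) l \<partial>\<mu>)"

context
  fixes f :: "(nat \<Rightarrow> int) \<Rightarrow> complex" and x :: "nat \<Rightarrow> int"
  assumes f: "integrable \<mu> f" and x: "x \<in> G"
begin

definition local_dev :: "nat \<Rightarrow> nat \<Rightarrow> real" where
  "local_dev l s = (\<integral>t. norm (f t - f x) * indicator (cyl l s x) t \<partial>\<mu>)"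

lemma integrable_local_dev:
  "A \<in> sets \<mu> \<Longrightarrow> integrable \<mu> (\<lambda>t. norm (f t - f x) * indicator A t)"
  using f by (intro integrable_times_bounded[where B = 1]) (auto simp: indicator_def)

lemma deviation_eq: "deviation f x l = (\<Sum>s\<le>l. real (M s) * local_dev l s)"
proof -
  have "deviation f x l =
      (\<integral>t. (\<Sum>s\<le>l. real (M s) * (norm (f t - f x) * indicator (cyl l s x) t)) \<partial>\<mu>)"
    unfolding deviation_def
    by (intro Bochner_Integration.integral_cong)
       (simp_all only: maj_ratio[OF x] space_\<mu> sum_distrib_left mult.left_commute)
  also have "\<dots> = (\<Sum>s\<le>l. real (M s) * local_dev l s)"
    by (subst Bochner_Integration.integral_sum)
       (auto simp: local_dev_def integrable_local_dev[OF cyl_sets])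
  finally show ?thesis .
qed

lemma local_dev_nonneg: "local_dev l s \<ge> 0"
  by (simp add: local_dev_def)

lemma local_dev_tendsto: "(\<lambda>l. local_dev l s) \<longlonglongrightarrow> 0"
  unfolding local_dev_def
proof (rule integral_indicator_decseq_tendsto_0)
  show "integrable \<mu> (\<lambda>t. norm (f t - f x))" using f by simp
  show "decseq (\<lambda>l. cyl l s x)" by (auto simp: decseq_def cyl_def)
  have "(\<lambda>l. measure \<mu> (cyl l s x)) \<longlonglongrightarrow> 0"
    by (rule tendsto_sandwich[OF _ _ tendsto_const tendsto_inverse_M[of "real b"]])
       (auto intro!: always_eventually measure_cyl_le[OF x])
  then show "(\<lambda>l. emeasure \<mu> (cyl l s x)) \<longlonglongrightarrow> 0"
    by (simp add: V.emeasure_eq_measure flip: ennreal_0)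
qed simp

text \<open>\<open>local_dev_tendsto\<close> fixes \<open>s\<close>, whereas here it moves with
  \<open>l\<close>; comparison with the larger cylinder \<open>cyl l 0 x\<close> removes the
  difficulty.\<close>

lemma local_dev_diag_tendsto: "(\<lambda>l. local_dev l l) \<longlonglongrightarrow> 0"
proof -
  have *: "local_dev l l \<le> local_dev l 0" for l
    unfolding local_dev_def
    by (intro integral_mono integrable_local_dev cyl_sets)
       (auto simp: cyl_def indicator_def)
  show ?thesis
    by (rule tendsto_sandwich[OF _ _ tendsto_const local_dev_tendsto[of 0]])
       (auto intro!: always_eventually local_dev_nonneg *)
qed

lemma local_dev_mono: "s \<le> l \<Longrightarrow> local_dev l l \<le> local_dev l s"
  unfolding local_dev_def
  by (intro integral_mono integrable_local_dev cyl_sets) (auto simp: cyl_def indicator_def)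

text \<open>For \<open>s < N\<close> the cylinders leave the region where \<open>f\<close> is
  controlled, but there are finitely many summands and each vanishes by absolute continuity. For
  \<open>s \<ge> N\<close> the cylinder lies inside I_N(x), where \<open>f\<close> is within
  \<open>d\<close> of \<open>f x\<close>.\<close>

lemma deviation_tendsto_0_continuous:
  assumes cont: "\<And>e. e > 0 \<Longrightarrow> \<exists>N. \<forall>t\<in>vil_I m N x. norm (f t - f x) < e"
  shows "deviation f x \<longlonglongrightarrow> 0"
proof (rule LIMSEQ_I)
  fix e :: real assume e: "e > 0"
  \<comment> \<open>The summands with \<open>s \<ge> N\<close> add up to at most
    \<open>2 * M l * d * b / M l = 2 * b * d\<close>, which is \<open>e / 2\<close>.\<close>
  define d where "d = e / (4 * real b)"
  have b0: "real b > 0" using b_ge_2 by simp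
  have d: "d > 0" using e b0 by (simp add: d_def)
  then obtain N where N: "\<And>t. t \<in> vil_I m N x \<Longrightarrow> norm (f t - f x) < d"
    using cont by blast
  have "(\<lambda>l. \<Sum>s<N. real (M s) * local_dev l s) \<longlonglongrightarrow> (\<Sum>s<N. real (M s) * 0)"
    by (intro tendsto_intros local_dev_tendsto)
  then obtain n0 where n0: "\<And>l. l \<ge> n0 \<Longrightarrow> norm ((\<Sum>s<N. real (M s) * local_dev l s) - 0) < e / 2"
    using LIMSEQ_D[of _ 0 "e / 2"] e by fastforce
  have "norm (deviation f x l - 0) < e" if l: "l \<ge> max N n0" for l
  proof -
    have far: "real (M s) * local_dev l s \<le> real (M s) * (d * (real b / real (M l)))"
      if s: "N \<le> s" for s
    proof -
      have "local_dev l s \<le> (\<integral>t. d * indicator (cyl l s x) t \<partial>\<mu>)"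
        unfolding local_dev_def
      proof (intro integral_mono integrable_local_dev cyl_sets)
        fix t
        have "t \<in> vil_I m N x" if "t \<in> cyl l s x"
          using that s l by (auto simp: cyl_def vil_I_def)
        then show "norm (f t - f x) * indicator (cyl l s x) t \<le> d * indicator (cyl l s x) t"
          using N[of t] by (auto simp: indicator_def)
      qed (simp add: V.emeasure_eq_measure)
      also have "\<dots> = d * measure \<mu> (cyl l s x)" by simp
      also have "\<dots> \<le> d * (real b / real (M l))"
        using d by (intro mult_left_mono measure_cyl_le[OF x]) auto
      finally show ?thesis by (intro mult_left_mono) auto
    qed
    have "deviation f x l = (\<Sum>s\<in>{..<N} \<union> {N..l}. real (M s) * local_dev l s)"
      unfolding deviation_eq using l by (intro sum.cong) auto
    also have "\<dots> = (\<Sum>s<N. real (M s) * local_dev l s) + (\<Sum>s\<in>{N..l}. real (M s) * local_dev l s)"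
      by (rule sum.union_disjoint) auto
    also have "(\<Sum>s\<in>{N..l}. real (M s) * local_dev l s) \<le>
        (\<Sum>s\<in>{N..l}. real (M s) * (d * (real b / real (M l))))"
      using far by (intro sum_mono) auto
    also have "\<dots> \<le> (\<Sum>s\<le>l. real (M s) * (d * (real b / real (M l))))"
      using d by (intro sum_mono2) auto
    also have "\<dots> = (\<Sum>s\<le>l. real (M s)) * (d * (real b / real (M l)))"
      by (rule sum_distrib_right[symmetric])
    also have "\<dots> \<le> 2 * real (M l) * (d * (real b / real (M l)))"
      using d by (intro mult_right_mono sum_M_le) auto
    also have "\<dots> = e / 2" using M_pos[of l] b0 by (simp add: d_def)
    finally have "deviation f x l < e" using n0[of l] l by simp
    moreover have "deviation f x l \<ge> 0"
      by (simp add: deviation_eq sum_nonneg local_dev_nonneg)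
    ultimately show ?thesis by simp
  qed
  then show "\<exists>n0. \<forall>l\<ge>n0. norm (deviation f x l - 0) < e" by blast
qed

text \<open>Exactly one residue, \<open>r0 = (x s - t s) mod m s\<close>, carries \<open>x\<close>
  to \<open>t\<close> in coordinate \<open>s\<close>. The sum omits residue 0, which accounts for
  I_n(x), the subtracted set.\<close>

lemma sum_indicator_shift:
  assumes t: "t \<in> G" and s: "s < n"
  shows "(\<Sum>r=1..m s - 1. indicator (vil_I m n (vil_shift m x r s)) t :: real) =
    indicator (cyl n s x) t - indicator (cyl n n x) t"
proof -
  define r0 where "r0 = nat ((x s - t s) mod int (m s))"
  have r0: "int r0 = (x s - t s) mod int (m s)" using m_pos[of s] by (simp add: r0_def)
  then have r0_less: "r0 < m s" using m_pos[of s] by (metis of_nat_0_less_iff of_nat_less_iff pos_mod_bound)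
  have xt: "0 \<le> x k" "x k < int (m k)" "0 \<le> t k" "t k < int (m k)" for k
    using x t by (auto simp: in_G)
  have r0_0: "r0 = 0 \<longleftrightarrow> t s = x s"
  proof
    assume "r0 = 0"
    then have "int (m s) dvd x s - t s" using r0 by (simp add: mod_eq_0_iff_dvd)
    then show "t s = x s" using xt[of s] zdvd_imp_le[of "int (m s)" "\<bar>x s - t s\<bar>"]
      by (cases "x s = t s") auto
  qed (simp add: r0_def)
  have shift: "t \<in> vil_I m n (vil_shift m x r s) \<longleftrightarrow> t \<in> cyl n s x \<and> r = r0"
    if r: "r \<in> {1..m s - 1}" for r
  proof -
    have sh: "vil_shift m x r s j = (if j = s then (x s - int r) mod int (m s) else x j)" for j
      unfolding vil_shift_eq[OF m_ge_2 x] using xt[of j] by simp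
    have "t s = (x s - int r) mod int (m s) \<longleftrightarrow> int r = (x s - t s) mod int (m s)"
    proof
      assume "t s = (x s - int r) mod int (m s)"
      then have "(x s - t s) mod int (m s) = int r mod int (m s)"
        by (simp add: mod_simps)
      moreover have "int r mod int (m s) = int r" using r by (intro mod_pos_pos_trivial) auto
      ultimately show "int r = (x s - t s) mod int (m s)" by simp
    next
      assume "int r = (x s - t s) mod int (m s)"
      then have "(x s - int r) mod int (m s) = t s mod int (m s)"
        by (simp add: mod_simps)
      then show "t s = (x s - int r) mod int (m s)" using xt[of s] by simp
    qed
    then have "t s = (x s - int r) mod int (m s) \<longleftrightarrow> r = r0"
      by (metis r0 of_nat_eq_iff)
    moreover have "t \<in> vil_I m n (vil_shift m x r s) \<longleftrightarrow>
        t \<in> cyl n s x \<and> t s = (x s - int r) mod int (m s)"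
      using s by (auto simp: vil_I_def cyl_def sh)
    ultimately show ?thesis by simp
  qed
  have "(\<Sum>r=1..m s - 1. indicator (vil_I m n (vil_shift m x r s)) t :: real) =
      (\<Sum>r=1..m s - 1. if r = r0 then indicator (cyl n s x) t else 0)"
    using shift by (intro sum.cong) (auto simp: indicator_def)
  also have "\<dots> = (if r0 \<in> {1..m s - 1} then indicator (cyl n s x) t else 0)"
    by (simp add: sum.delta)
  also have "\<dots> = indicator (cyl n s x) t - indicator (cyl n n x) t"
  proof (cases "t s = x s")
    case True
    then have "t \<in> cyl n s x \<longleftrightarrow> t \<in> cyl n n x" by (auto simp: cyl_def)
    then show ?thesis using True r0_0 by (auto simp: indicator_def)
  next
    case False
    then have "t \<notin> cyl n n x" using s by (auto simp: cyl_def)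
    then show ?thesis using False r0_0 r0_less by (auto simp: indicator_def)
  qed
  finally show ?thesis .
qed

lemma vil_W_eq: "vil_W m n f x = (\<Sum>s<n. real (M s) * (local_dev n s - local_dev n n))"
  unfolding vil_W_def
proof (intro sum.cong arg_cong2[where f = "(*)"] refl)
  fix s assume "s \<in> {..<n}"
  then have s: "s < n" by simp
  have "(\<Sum>r=1..m s - 1. LINT t:vil_I m n (vil_shift m x r s)|\<mu>. norm (f t - f x)) =
      (\<Sum>r=1..m s - 1. \<integral>t. norm (f t - f x) * indicator (vil_I m n (vil_shift m x r s)) t \<partial>\<mu>)"
    by (simp add: set_lebesgue_integral_def mult.commute)
  also have "\<dots> = (\<integral>t. (\<Sum>r=1..m s - 1. norm (f t - f x) * indicator (vil_I m n (vil_shift m x r s)) t) \<partial>\<mu>)"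
    by (subst Bochner_Integration.integral_sum)
       (auto simp: vil_I_eq_cyl intro!: integrable_local_dev[OF cyl_sets])
  also have "\<dots> = (\<integral>t. norm (f t - f x) * indicator (cyl n s x) t
      - norm (f t - f x) * indicator (cyl n n x) t \<partial>\<mu>)"
    by (intro Bochner_Integration.integral_cong)
       (simp_all only: sum_distrib_left[symmetric] sum_indicator_shift[OF _ s] space_\<mu> right_diff_distrib)
  also have "\<dots> = local_dev n s - local_dev n n"
    unfolding local_dev_def
    by (intro Bochner_Integration.integral_diff integrable_local_dev cyl_sets)
  finally show "(\<Sum>r=1..m s - 1. LINT t:vil_I m n (vil_shift m x r s)|\<mu>. norm (f t - f x)) =
      local_dev n s - local_dev n n" .
qed

text \<open>The sum \<open>vil_W\<close> omits \<open>I\<^sub>l(x)\<close> itself, but \<open>I\<^sub>l(x) - I\<^bsub>l+1\<^esub>(x)\<close> is among the sets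
  occurring in \<open>vil_W m (l + 1)\<close>; telescoping over \<open>l\<close> recovers \<open>I\<^sub>l(x)\<close>.\<close>

lemma deviation_tendsto_0_lebesgue:
  assumes W: "(\<lambda>n. vil_W m n f x) \<longlonglongrightarrow> 0"
  shows "deviation f x \<longlonglongrightarrow> 0"
proof -
  define J where "J l = local_dev l l" for l
  have step: "real (M l) * (J l - J (Suc l)) \<le> vil_W m (Suc l) f x" for l
  proof -
    have "cyl l l x = cyl (Suc l) l x" by (auto simp: cyl_def less_Suc_eq)
    then have "J l = local_dev (Suc l) l" by (simp add: J_def local_dev_def)
    then have "real (M l) * (J l - J (Suc l)) = real (M l) * (local_dev (Suc l) l - local_dev (Suc l) (Suc l))"
      by (simp add: J_def)
    also have "\<dots> \<le> vil_W m (Suc l) f x"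
      unfolding vil_W_eq using local_dev_mono[of _ "Suc l"]
      by (intro member_le_sum[where f = "\<lambda>s. real (M s) * (local_dev (Suc l) s - local_dev (Suc l) (Suc l))"])
         auto
    finally show ?thesis .
  qed
  have MJ: "(\<lambda>l. real (M l) * J l) \<longlonglongrightarrow> 0"
  proof (rule LIMSEQ_I)
    fix e :: real assume e: "e > 0"
    define d where "d = e / 4"
    have d: "d > 0" using e by (simp add: d_def)
    obtain N where N: "\<And>n. n \<ge> N \<Longrightarrow> norm (vil_W m n f x - 0) < d"
      using LIMSEQ_D[OF W d] by blast
    have "norm (real (M l) * J l - 0) < e" if l: "l \<ge> N" for l
    proof -
      \<comment> \<open>Telescoping in monotone form: each decrement of \<open>J\<close> is at most
        \<open>d / M (l + k)\<close>, and since \<open>M\<close> at least doubles, the correction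
        \<open>2 * d / M (l + k)\<close> drops by at least as much. So \<open>P\<close> increases to
        0 and \<open>P 0 \<le> 0\<close>.\<close>
      define P where "P k = J (l + k) - 2 * d / real (M (l + k))" for k
      have "P k \<le> P (Suc k)" for k
      proof -
        have "real (M (l + k)) * (J (l + k) - J (Suc (l + k))) \<le> d"
          using step[of "l + k"] N[of "Suc (l + k)"] l by simp
        then have "J (l + k) - J (Suc (l + k)) \<le> d / real (M (l + k))"
          using M_pos[of "l + k"] by (simp add: field_simps)
        moreover have "2 * d / real (M (Suc (l + k))) \<le> d / real (M (l + k))"
        proof -
          have "real (M (l + k)) * 2 \<le> real (M (l + k)) * real (m (l + k))"
            using m_ge_2[of "l + k"] by (intro mult_left_mono) auto
          then have "2 * real (M (l + k)) \<le> real (M (Suc (l + k)))"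
            by (simp add: M_Suc)
          then show ?thesis using d M_pos[of "l + k"] M_pos[of "Suc (l + k)"]
            by (simp add: field_simps)
        qed
        ultimately show ?thesis by (simp add: P_def)
      qed
      then have "incseq P" by (rule incseq_SucI)
      moreover have "P \<longlonglongrightarrow> 0 - 0"
        unfolding P_def
        using LIMSEQ_ignore_initial_segment[OF local_dev_diag_tendsto, of l]
          LIMSEQ_ignore_initial_segment[OF tendsto_inverse_M[of "2 * d"], of l]
        by (intro tendsto_diff) (simp_all add: J_def add.commute)
      ultimately have "P 0 \<le> 0" using incseq_le[of P 0 0] by simp
      then have "real (M l) * J l \<le> 2 * d"
        using M_pos[of l] by (simp add: P_def field_simps)
      moreover have "J l \<ge> 0" by (simp add: J_def local_dev_nonneg)
      ultimately show ?thesis using e by (simp add: d_def)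
    qed
    then show "\<exists>N. \<forall>l\<ge>N. norm (real (M l) * J l - 0) < e" by blast
  qed
  \<comment> \<open>Every summand of \<open>vil_W\<close> lacks \<open>J l\<close>; restoring it for
    all \<open>s\<close>, together with the summand \<open>s = l\<close>, costs \<open>J l\<close>
    times a sum of \<open>M s\<close> that is at most \<open>2 * M l\<close>.\<close>
  have le: "deviation f x l \<le> vil_W m l f x + 2 * (real (M l) * J l)" for l
  proof -
    have "deviation f x l = (\<Sum>s<l. real (M s) * local_dev l s) + real (M l) * J l"
      by (simp add: deviation_eq J_def lessThan_Suc_atMost[symmetric])
    also have "(\<Sum>s<l. real (M s) * local_dev l s) = vil_W m l f x + (\<Sum>s<l. real (M s)) * J l"
      by (simp only: vil_W_eq J_def right_diff_distrib sum_subtractf sum_distrib_right[symmetric] diff_add_cancel)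
    finally have "deviation f x l = vil_W m l f x + (\<Sum>s\<le>l. real (M s)) * J l"
      by (simp add: lessThan_Suc_atMost[symmetric] algebra_simps)
    also have "(\<Sum>s\<le>l. real (M s)) * J l \<le> 2 * real (M l) * J l"
      by (intro mult_right_mono sum_M_le) (simp add: J_def local_dev_nonneg)
    finally show ?thesis by simp
  qed
  have ge: "deviation f x l \<ge> 0" for l
    by (simp add: deviation_eq sum_nonneg local_dev_nonneg)
  have "(\<lambda>l. vil_W m l f x + 2 * (real (M l) * J l)) \<longlonglongrightarrow> 0 + 2 * 0"
    by (intro tendsto_intros W MJ)
  then have "(\<lambda>l. vil_W m l f x + 2 * (real (M l) * J l)) \<longlonglongrightarrow> 0" by simp
  from tendsto_sandwich[OF _ _ tendsto_const this] show ?thesis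
    using le ge by simp
qed

end

end

subsection \<open>Kernels of the T means\<close>

text \<open>\<open>weight_bound\<close> controls the total mass of the majorant of the kernel,
  \<open>variation\<close> makes its share at each fixed level vanish. The index is
  \<open>Suc n\<close> throughout because \<open>Q_sum q 0 = 0\<close>.\<close>

locale vilenkin_weights = bounded_vilenkin +
  fixes q :: "nat \<Rightarrow> real" and C :: real
  assumes q_nonneg: "q k \<ge> 0" and q_0: "q 0 > 0"
    and weight_bound:
      "q n * real (Suc n) + (\<Sum>k<n. \<bar>q k - q (Suc k)\<bar> * real (Suc k)) \<le> C * Q_sum q (Suc n)"
    and variation:
      "(\<lambda>n. (q n + (\<Sum>k<n. \<bar>q k - q (Suc k)\<bar>)) / Q_sum q (Suc n)) \<longlonglongrightarrow> 0"
begin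

lemma Q_pos: "Q_sum q (Suc n) > 0"
  unfolding Q_sum_def lessThan_Suc_eq_insert_0 using q_0 q_nonneg
  by (subst sum.insert) (auto intro!: add_pos_nonneg sum_nonneg)

lemma C_nonneg: "C \<ge> 0"
  using weight_bound[of 0] q_0 Q_pos[of 0] by (auto simp: Q_sum_def zero_le_mult_iff)

definition kernel :: "nat \<Rightarrow> (nat \<Rightarrow> complex) \<Rightarrow> complex" where
  "kernel n \<theta> = (\<Sum>k<Suc n. of_real (q k) * dir \<theta> k) / of_real (Q_sum q (Suc n))"

text \<open>The coefficient of \<open>maj \<theta> l\<close> that arises when
  \<open>norm_fej_le\<close>, with its constant \<open>2 * b ^ 2\<close>, is inserted into
  \<open>abel_summation\<close>.\<close>

definition weight :: "nat \<Rightarrow> nat \<Rightarrow> real" where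
  "weight n l = 2 * real b ^ 2 * real (M l) / Q_sum q (Suc n) *
     (q n * of_bool (M l \<le> Suc n) + (\<Sum>k<n. \<bar>q k - q (Suc k)\<bar> * of_bool (M l \<le> Suc k)))"

definition major :: "nat \<Rightarrow> (nat \<Rightarrow> complex) \<Rightarrow> real" where
  "major n \<theta> = (\<Sum>l<Suc n. weight n l * maj \<theta> l)"

lemma weight_nonneg: "weight n l \<ge> 0"
  using Q_pos[of n] q_nonneg[of n] unfolding weight_def
  by (intro mult_nonneg_nonneg divide_nonneg_pos add_nonneg_nonneg sum_nonneg) auto

lemma major_nonneg: "major n \<theta> \<ge> 0"
  by (simp add: major_def sum_nonneg weight_nonneg maj_nonneg)

lemma abel_summation:
  "(\<Sum>k<Suc n. of_real (q k) * dir \<theta> k) =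
   of_real (q n) * fej \<theta> (Suc n) + (\<Sum>k<n. of_real (q k - q (Suc k)) * fej \<theta> (Suc k))"
proof (induction n)
  case (Suc n)
  have "fej \<theta> (Suc (Suc n)) = fej \<theta> (Suc n) + dir \<theta> (Suc n)" by (simp add: fej_def)
  then show ?case using Suc by (simp add: algebra_simps)
qed (simp add: fej_def)

lemma norm_kernel_le:
  assumes norm_1: "\<And>k. norm (\<theta> k) = 1" and root: "\<And>k. \<theta> k ^ m k = 1"
  shows "norm (kernel n \<theta>) \<le> major n \<theta>"
proof -
  have fej: "norm (fej \<theta> (Suc k)) \<le>
      2 * real b ^ 2 * (\<Sum>l<Suc n. real (M l) * of_bool (M l \<le> Suc k) * maj \<theta> l)" if "k \<le> n" for k
  proof -
    \<comment> \<open>Since \<open>Suc k < M (Suc k)\<close>, the levels \<open>l < Suc n\<close>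
      serve all Fejer kernels of the Abel sum at once.\<close>
    have "Suc k < M (Suc n)" using less_M[of "Suc k"] M_mono[of "Suc k" "Suc n"] that by simp
    from norm_fej_le[OF norm_1 root this] show ?thesis
      by (rule order.trans) (intro mult_left_mono sum_mono, auto)
  qed
  have "norm (\<Sum>k<Suc n. of_real (q k) * dir \<theta> k) \<le>
      norm (of_real (q n) * fej \<theta> (Suc n)) + (\<Sum>k<n. norm (of_real (q k - q (Suc k)) * fej \<theta> (Suc k)))"
    unfolding abel_summation by (intro norm_triangle_le add_left_mono norm_sum)
  also have "\<dots> = q n * norm (fej \<theta> (Suc n)) + (\<Sum>k<n. \<bar>q k - q (Suc k)\<bar> * norm (fej \<theta> (Suc k)))"
    using q_nonneg[of n] by (simp only: norm_mult norm_of_real abs_of_nonneg)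
  also have "\<dots> \<le> q n * (2 * real b ^ 2 * (\<Sum>l<Suc n. real (M l) * of_bool (M l \<le> Suc n) * maj \<theta> l)) +
      (\<Sum>k<n. \<bar>q k - q (Suc k)\<bar> *
        (2 * real b ^ 2 * (\<Sum>l<Suc n. real (M l) * of_bool (M l \<le> Suc k) * maj \<theta> l)))"
    using q_nonneg by (intro add_mono sum_mono mult_left_mono fej) auto
  also have "\<dots> = (\<Sum>l<Suc n. 2 * real b ^ 2 * real (M l) *
      (q n * of_bool (M l \<le> Suc n) + (\<Sum>k<n. \<bar>q k - q (Suc k)\<bar> * of_bool (M l \<le> Suc k))) * maj \<theta> l)"
    unfolding sum_distrib_left sum.swap[of _ "{..<Suc n}" "{..<n}"] sum.distrib[symmetric]
    by (intro sum.cong refl) (simp only: sum_distrib_left sum_distrib_right distrib_left distrib_right mult_ac)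
  also have "\<dots> = Q_sum q (Suc n) * major n \<theta>"
    unfolding major_def weight_def sum_distrib_left using Q_pos[of n] by (intro sum.cong) auto
  finally show ?thesis
    using Q_pos[of n] by (simp add: kernel_def norm_divide divide_le_eq mult.commute)
qed

text \<open>After exchanging the sums, \<open>sum_M_restrict_le\<close> turns each truncated sum
  over \<open>l\<close> into at most twice the kernel index; what remains is the left side of
  \<open>weight_bound\<close>.\<close>

lemma sum_weight_le: "(\<Sum>l<Suc n. weight n l) \<le> 4 * real b ^ 2 * C"
proof -
  define K where "K = 2 * real b ^ 2 / Q_sum q (Suc n)"
  have K: "K \<ge> 0" using Q_pos[of n] by (simp add: K_def)
  have M_sum: "(\<Sum>l<Suc n. real (M l) * of_bool (M l \<le> j)) \<le> 2 * real j" for j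
    using sum_M_restrict_le[of j "Suc n"]
    by (rule order.trans[rotated]) (intro sum_mono, auto)
  have "(\<Sum>l<Suc n. weight n l) = K * (q n * (\<Sum>l<Suc n. real (M l) * of_bool (M l \<le> Suc n)) +
      (\<Sum>k<n. \<bar>q k - q (Suc k)\<bar> * (\<Sum>l<Suc n. real (M l) * of_bool (M l \<le> Suc k))))"
    unfolding sum_distrib_left sum.swap[of _ "{..<Suc n}" "{..<n}"] sum.distrib[symmetric] distrib_left weight_def K_def
    by (intro sum.cong refl) (simp only: sum_distrib_left sum_distrib_right mult_ac times_divide_eq_left times_divide_eq_right)
  also have "\<dots> \<le> K * (q n * (2 * real (Suc n)) + (\<Sum>k<n. \<bar>q k - q (Suc k)\<bar> * (2 * real (Suc k))))"
    using q_nonneg by (intro mult_left_mono[OF _ K] add_mono sum_mono mult_left_mono M_sum) auto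
  also have "\<dots> = 2 * K * (q n * real (Suc n) + (\<Sum>k<n. \<bar>q k - q (Suc k)\<bar> * real (Suc k)))"
    by (simp only: sum_distrib_left distrib_left mult_ac)
  also have "\<dots> \<le> 2 * K * (C * Q_sum q (Suc n))"
    using K by (intro mult_left_mono weight_bound) auto
  also have "\<dots> = 4 * real b ^ 2 * C"
    using Q_pos[of n] by (simp add: K_def)
  finally show ?thesis .
qed

text \<open>For fixed \<open>l\<close> the factor \<open>M l\<close> is constant, and dropping the
  truncations leaves the quotient in \<open>variation\<close>.\<close>

lemma weight_tendsto_0: "(\<lambda>n. weight n l) \<longlonglongrightarrow> 0"
proof (rule tendsto_sandwich[OF _ _ tendsto_const])
  define V where "V n = q n + (\<Sum>k<n. \<bar>q k - q (Suc k)\<bar>)" for n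
  have "weight n l \<le> 2 * real b ^ 2 * real (M l) * (V n / Q_sum q (Suc n))" for n
  proof -
    have "weight n l \<le> 2 * real b ^ 2 * real (M l) / Q_sum q (Suc n) * V n"
      unfolding weight_def V_def using Q_pos[of n] q_nonneg[of n]
      by (intro mult_left_mono add_mono sum_mono) auto
    then show ?thesis by simp
  qed
  then show "\<forall>\<^sub>F n in sequentially. weight n l \<le> 2 * real b ^ 2 * real (M l) * (V n / Q_sum q (Suc n))"
    by simp
  show "(\<lambda>n. 2 * real b ^ 2 * real (M l) * (V n / Q_sum q (Suc n))) \<longlonglongrightarrow> 0"
    unfolding V_def by (intro tendsto_mult_right_zero variation)
qed (simp add: weight_nonneg)

text \<open>Telescoping bounds \<open>q 0\<close> by \<open>q n\<close> plus the total variation, so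
  \<open>variation\<close> already contains the divergence of \<open>Q_sum q\<close>.\<close>

lemma q_0_over_Q: "(\<lambda>n. q 0 / Q_sum q (Suc n)) \<longlonglongrightarrow> 0"
proof (rule tendsto_sandwich[OF _ _ tendsto_const variation])
  have "q 0 \<le> q n + (\<Sum>k<n. \<bar>q k - q (Suc k)\<bar>)" for n
  proof (induction n)
    case (Suc n)
    then show ?case by simp
  qed simp
  then show "\<forall>\<^sub>F n in sequentially. q 0 / Q_sum q (Suc n) \<le>
      (q n + (\<Sum>k<n. \<bar>q k - q (Suc k)\<bar>)) / Q_sum q (Suc n)"
    using Q_pos by (intro always_eventually allI divide_right_mono) (auto intro: less_imp_le)
  show "\<forall>\<^sub>F n in sequentially. 0 \<le> q 0 / Q_sum q (Suc n)"
    using Q_pos q_0 by (intro always_eventually allI divide_nonneg_pos) auto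
qed

section \<open>Integral representation of the T means and pointwise convergence\<close>

lemma integrable_times_psi: "integrable \<mu> f \<Longrightarrow> integrable \<mu> (\<lambda>t. f t * cnj (vil_psi m k t))"
  by (rule integrable_times_bounded[where B = 1]) (auto simp: norm_psi)

lemma vil_S_eq:
  assumes "integrable \<mu> f"
  shows "integrable \<mu> (\<lambda>t. f t * dir (ratio x t) n)" "vil_S m n f x = (\<integral>t. f t * dir (ratio x t) n \<partial>\<mu>)"
proof -
  have eq: "f t * dir (ratio x t) n = (\<Sum>k<n. f t * cnj (vil_psi m k t) * vil_psi m k x)" for t
    by (simp add: dir_def chr_ratio sum_distrib_left mult_ac)
  show "integrable \<mu> (\<lambda>t. f t * dir (ratio x t) n)"
    unfolding eq using assms by (intro Bochner_Integration.integrable_sum integrable_mult_left integrable_times_psi)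
  show "vil_S m n f x = (\<integral>t. f t * dir (ratio x t) n \<partial>\<mu>)"
    unfolding eq vil_S_def vil_coeff_def using assms
    by (subst Bochner_Integration.integral_sum) (auto intro!: integrable_mult_left integrable_times_psi)
qed

lemma T_mean_eq:
  assumes "integrable \<mu> f"
  shows "integrable \<mu> (\<lambda>t. f t * kernel n (ratio x t))"
    "T_mean m q (Suc n) f x = (\<integral>t. f t * kernel n (ratio x t) \<partial>\<mu>)"
proof -
  have eq: "f t * kernel n (ratio x t) =
      (\<Sum>k<Suc n. of_real (q k) * (f t * dir (ratio x t) k)) / of_real (Q_sum q (Suc n))" for t
    by (simp only: kernel_def sum_distrib_left times_divide_eq_right mult_ac)
  have int: "integrable \<mu> (\<lambda>t. \<Sum>k<Suc n. of_real (q k) * (f t * dir (ratio x t) k))"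
    using assms by (intro Bochner_Integration.integrable_sum integrable_mult_right vil_S_eq)
  show "integrable \<mu> (\<lambda>t. f t * kernel n (ratio x t))"
    unfolding eq by (rule integrable_divide_zero[OF int])
  have "(\<integral>t. f t * kernel n (ratio x t) \<partial>\<mu>) =
      (\<Sum>k<Suc n. of_real (q k) * vil_S m k f x) / of_real (Q_sum q (Suc n))"
    unfolding eq using assms
    by (simp only: integral_divide_zero, subst Bochner_Integration.integral_sum)
       (auto intro!: integrable_mult_right vil_S_eq(1) simp: vil_S_eq(2))
  then show "T_mean m q (Suc n) f x = (\<integral>t. f t * kernel n (ratio x t) \<partial>\<mu>)"
    by (simp add: T_mean_def)
qed

text \<open>The integral is the T mean of the constant 1: all partial sums equal 1 except S_0 = 0,
  whose share is the defect \<open>q 0 / Q_sum q (Suc n)\<close>.\<close>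

lemma integral_kernel: "(\<integral>t. kernel n (ratio x t) \<partial>\<mu>) = of_real (1 - q 0 / Q_sum q (Suc n))"
proof -
  have coeff: "vil_coeff m (\<lambda>_. 1) k = of_bool (k = 0)" for k
  proof -
    have "vil_coeff m (\<lambda>_. 1) k = cnj (\<integral>t. vil_psi m k t \<partial>\<mu>)"
      by (simp add: vil_coeff_def)
    also have "\<dots> = of_bool (k = 0)"
    proof (cases "k = 0")
      case True
      then show ?thesis by (simp add: psi_eq V.prob_space)
    next
      case False
      then show ?thesis using integral_psi[of k] by simp
    qed
    finally show ?thesis .
  qed
  have S: "vil_S m n (\<lambda>_. 1) x = of_bool (n > 0)" for n
    by (cases n) (simp_all add: vil_S_def coeff psi_eq sum.lessThan_Suc_shift del: sum.lessThan_Suc)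
  have "(\<integral>t. kernel n (ratio x t) \<partial>\<mu>) = T_mean m q (Suc n) (\<lambda>_. 1) x"
    by (subst T_mean_eq) auto
  also have "\<dots> = (\<Sum>k<Suc n. of_real (q k) * of_bool (k > 0)) / of_real (Q_sum q (Suc n))"
    by (simp add: T_mean_def S)
  also have "(\<Sum>k<Suc n. of_real (q k) * of_bool (k > 0)) = (of_real (Q_sum q (Suc n) - q 0) :: complex)"
    unfolding Q_sum_def by (simp only: sum.lessThan_Suc_shift) simp
  also have "\<dots> / of_real (Q_sum q (Suc n)) = of_real (1 - q 0 / Q_sum q (Suc n))"
    using Q_pos[of n] by (simp add: field_simps)
  finally show ?thesis .
qed

lemma integrable_norm_times_maj:
  fixes f :: "(nat \<Rightarrow> int) \<Rightarrow> complex"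
  shows "integrable \<mu> f \<Longrightarrow> x \<in> G \<Longrightarrow> integrable \<mu> (\<lambda>t. norm (f t) * maj (ratio x t) l)"
  by (rule integrable_times_bounded[where B = "2 * real (M l)"])
     (auto simp: maj_measurable_2 maj_le maj_nonneg)

lemma integral_kernel_le:
  assumes f: "integrable \<mu> f" and x: "x \<in> G"
  shows "norm (\<integral>t. f t * kernel n (ratio x t) \<partial>\<mu>) \<le>
    (\<Sum>l<Suc n. weight n l * (\<integral>t. norm (f t) * maj (ratio x t) l \<partial>\<mu>))"
proof -
  have eq: "norm (f t) * major n (ratio x t) = (\<Sum>l<Suc n. weight n l * (norm (f t) * maj (ratio x t) l))" for t
    by (simp only: major_def sum_distrib_left mult_ac)
  have int: "integrable \<mu> (\<lambda>t. norm (f t) * major n (ratio x t))"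
    unfolding eq using f x
    by (intro Bochner_Integration.integrable_sum integrable_mult_right integrable_norm_times_maj)
  have "norm (\<integral>t. f t * kernel n (ratio x t) \<partial>\<mu>) \<le> (\<integral>t. norm (f t) * major n (ratio x t) \<partial>\<mu>)"
  proof (rule order.trans[OF integral_norm_bound integral_mono])
    show "integrable \<mu> (\<lambda>t. norm (f t * kernel n (ratio x t)))"
      by (intro integrable_norm T_mean_eq f)
  qed (auto simp: norm_mult norm_ratio ratio_power intro!: int mult_left_mono norm_kernel_le)
  also have "\<dots> = (\<Sum>l<Suc n. weight n l * (\<integral>t. norm (f t) * maj (ratio x t) l \<partial>\<mu>))"
    unfolding eq using f x
    by (subst Bochner_Integration.integral_sum) (auto intro!: integrable_mult_right integrable_norm_times_maj)
  finally show ?thesis .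
qed

text \<open>Subtracting \<open>f x\<close> under the integral leaves the defect of
  \<open>integral_kernel\<close> as a separate vanishing term; the rest is a Toeplitz sum of
  deviations.\<close>

lemma T_mean_tendsto:
  assumes f: "integrable \<mu> f" and x: "x \<in> G" and dev: "deviation f x \<longlonglongrightarrow> 0"
  shows "(\<lambda>n. T_mean m q n f x) \<longlonglongrightarrow> f x"
proof -
  define E where "E n = (\<Sum>l<Suc n. weight n l * deviation f x l) + q 0 / Q_sum q (Suc n) * norm (f x)" for n
  have le: "norm (T_mean m q (Suc n) f x - f x) \<le> E n" for n
  proof -
    have fx: "integrable \<mu> (\<lambda>t. f t - f x)" using f by simp
    have "(\<integral>t. (f t - f x) * kernel n (ratio x t) \<partial>\<mu>) =
        (\<integral>t. f t * kernel n (ratio x t) \<partial>\<mu>) - (\<integral>t. f x * kernel n (ratio x t) \<partial>\<mu>)"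
      unfolding left_diff_distrib using f
      by (intro Bochner_Integration.integral_diff T_mean_eq) auto
    also have "\<dots> = T_mean m q (Suc n) f x - f x * of_real (1 - q 0 / Q_sum q (Suc n))"
      using f by (simp add: T_mean_eq integral_kernel)
    finally have "T_mean m q (Suc n) f x - f x =
        (\<integral>t. (f t - f x) * kernel n (ratio x t) \<partial>\<mu>) - of_real (q 0 / Q_sum q (Suc n)) * f x"
      by (simp add: algebra_simps)
    then have "norm (T_mean m q (Suc n) f x - f x) \<le>
        norm (\<integral>t. (f t - f x) * kernel n (ratio x t) \<partial>\<mu>) + norm (of_real (q 0 / Q_sum q (Suc n)) * f x)"
      by (simp only: norm_triangle_ineq4)
    also have "norm (of_real (q 0 / Q_sum q (Suc n)) * f x) = q 0 / Q_sum q (Suc n) * norm (f x)"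
      using q_0 Q_pos[of n] by (simp add: norm_mult norm_divide)
    also have "norm (\<integral>t. (f t - f x) * kernel n (ratio x t) \<partial>\<mu>) \<le> (\<Sum>l<Suc n. weight n l * deviation f x l)"
      unfolding deviation_def by (rule integral_kernel_le[OF fx x])
    finally show ?thesis by (simp add: E_def)
  qed
  have dev_nonneg: "deviation f x l \<ge> 0" for l
    by (simp add: deviation_def maj_nonneg)
  have "E \<longlonglongrightarrow> 0 + 0 * norm (f x)"
    unfolding E_def
    by (intro tendsto_add tendsto_mult tendsto_const q_0_over_Q
        summation_matrix_tendsto_0[OF weight_nonneg sum_weight_le weight_tendsto_0 dev dev_nonneg])
  then have "(\<lambda>n. T_mean m q (Suc n) f x - f x) \<longlonglongrightarrow> 0"
    by (intro Lim_null_comparison[OF always_eventually[OF allI[OF le]]]) simp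
  then have "(\<lambda>n. T_mean m q (Suc n) f x) \<longlonglongrightarrow> f x" by (simp only: LIM_zero_iff)
  then show ?thesis by (rule LIMSEQ_imp_Suc)
qed

end

subsection \<open>Convergence in \<open>L\<^sub>p\<close>\<close>

text \<open>Convexity is available on the open half-line, so zero arguments are separate. At
  \<open>y = 0\<close> the left side is 0 because \<open>0 powr s = 0\<close> for every
  \<open>s\<close>, including \<open>p - 1 = 0\<close>.\<close>

lemma powr_above_tangent:
  fixes a y p :: real
  assumes p: "1 \<le> p" and a: "0 \<le> a" and y: "0 \<le> y"
  shows "y powr p + p * y powr (p - 1) * (a - y) \<le> a powr p"
proof -
  consider "y = 0" | "y > 0" "a = 0" | "y > 0" "a > 0" using a y by linarith
  then show ?thesis
  proof cases
    case 1
    then show ?thesis by simp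
  next
    case 2
    have "y powr (p - 1) * y = y powr p" using 2 by (simp add: powr_diff)
    then have "y powr p + p * y powr (p - 1) * (a - y) = (1 - p) * y powr p"
      using 2 by (simp add: algebra_simps)
    also have "\<dots> \<le> 0" using p by (intro mult_nonpos_nonneg) auto
    finally show ?thesis using 2 by simp
  next
    case 3
    have "p * y powr (p - 1) * (a - y) \<le> a powr p - y powr p"
    proof (rule convex_on_imp_above_tangent[where A = "{0<..}"])
      show "convex_on {0<..} (\<lambda>x. x powr p)" by (rule powr_convex[OF p])
      show "((\<lambda>x. x powr p) has_real_derivative p * y powr (p - 1)) (at y within {0<..})"
        using 3 by (auto intro!: derivative_eq_intros)
    qed (use 3 in \<open>auto simp: interior_open\<close>)
    then show ?thesis by simp
  qed
qed

text \<open>Jensen's inequality for the density \<open>w\<close> of mass at most \<open>A\<close>,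
  by integrating the tangent inequality at \<open>y = I / A\<close>. Dividing by the bound
  \<open>A\<close> instead of the mass itself avoids a case of mass 0.\<close>

lemma powr_integral_le:
  fixes g w :: "'a \<Rightarrow> real"
  assumes p: "1 \<le> p" and g: "\<And>x. 0 \<le> g x" and w: "\<And>x. 0 \<le> w x"
    and int_w: "integrable M w" and int_gw: "integrable M (\<lambda>x. g x * w x)"
    and int_gpw: "integrable M (\<lambda>x. g x powr p * w x)"
    and A: "(\<integral>x. w x \<partial>M) \<le> A" "0 < A"
  shows "(\<integral>x. g x * w x \<partial>M) powr p \<le> A powr (p - 1) * (\<integral>x. g x powr p * w x \<partial>M)"
proof -
  define W I y where "W = (\<integral>x. w x \<partial>M)" and "I = (\<integral>x. g x * w x \<partial>M)" and "y = I / A"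
  have I: "I \<ge> 0" unfolding I_def by (intro integral_nonneg_AE) (auto simp: g w)
  have y: "y \<ge> 0" using I A by (simp add: y_def)
  have yp: "y * y powr (p - 1) = y powr p" using y by (cases "y = 0") (auto simp: powr_diff)
  \<comment> \<open>With \<open>I = y * A\<close> the right side is
    \<open>p * y powr p * A - (p - 1) * y powr p * W\<close>, and \<open>W \<le> A\<close> gives the
    claim.\<close>
  have "A * y powr p \<le> y powr p * W + p * y powr (p - 1) * (I - y * W)"
  proof -
    have "(p - 1) * y powr p * W \<le> (p - 1) * y powr p * A"
      using p A by (intro mult_left_mono) (auto simp: W_def)
    moreover have "y powr p * W + p * y powr (p - 1) * (I - y * W) =
        p * (y * y powr (p - 1)) * A + y powr p * W - p * (y * y powr (p - 1)) * W"
      using A by (simp add: y_def algebra_simps)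
    ultimately show ?thesis unfolding yp by (simp add: algebra_simps)
  qed
  also have "\<dots> = (\<integral>x. y powr p * w x + p * y powr (p - 1) * (g x * w x - y * w x) \<partial>M)"
    using int_w int_gw by (simp add: W_def I_def)
  also have "\<dots> \<le> (\<integral>x. g x powr p * w x \<partial>M)"
  proof (intro integral_mono int_gpw)
    fix x
    have "(y powr p + p * y powr (p - 1) * (g x - y)) * w x \<le> g x powr p * w x"
      by (intro mult_right_mono powr_above_tangent p g y w)
    then show "y powr p * w x + p * y powr (p - 1) * (g x * w x - y * w x) \<le> g x powr p * w x"
      by (simp add: algebra_simps)
  qed (use int_w int_gw in auto)
  finally have "A powr (p - 1) * (A * y powr p) \<le> A powr (p - 1) * (\<integral>x. g x powr p * w x \<partial>M)"
    by (intro mult_left_mono) auto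
  moreover have "A powr (p - 1) * (A * y powr p) = I powr p"
  proof -
    have "A powr (p - 1) * A = A powr p" using A by (simp add: powr_diff)
    then have "A powr (p - 1) * (A * y powr p) = A powr p * y powr p" by (simp flip: mult.assoc)
    also have "\<dots> = (A * y) powr p" using A y by (simp add: powr_mult)
    finally show ?thesis using A by (simp add: y_def)
  qed
  ultimately show ?thesis by (simp add: I_def)
qed

lemma powr_add_le:
  fixes a c p :: real
  assumes "0 \<le> a" "0 \<le> c" "0 \<le> p"
  shows "(a + c) powr p \<le> 2 powr p * (a powr p + c powr p)"
proof -
  have "(a + c) powr p \<le> (2 * max a c) powr p"
    using assms by (intro powr_mono2) auto
  also have "\<dots> = 2 powr p * max a c powr p" using assms by (simp add: powr_mult)
  also have "\<dots> \<le> 2 powr p * (a powr p + c powr p)"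
    by (intro mult_left_mono) (auto simp: max_def)
  finally show ?thesis .
qed

lemma norm_add_powr_le:
  fixes u v :: "'a::real_normed_vector"
  assumes "0 \<le> p"
  shows "norm (u + v) powr p \<le> 2 powr p * (norm u powr p + norm v powr p)"
  by (rule order.trans[OF powr_mono2 powr_add_le]) (use assms norm_triangle_ineq in auto)

locale vilenkin_weights_Lp = vilenkin_weights +
  fixes p :: real
  assumes p: "1 \<le> p"
begin

text \<open>The p-th power of \<open>vil_norm\<close>. For convergence to 0 the crude triangle
  inequality with factor \<open>2 powr p\<close> is enough, so the modular takes the place of the
  norm.\<close>

definition modular :: "((nat \<Rightarrow> int) \<Rightarrow> complex) \<Rightarrow> real" where
  "modular f = (\<integral>x. norm (f x) powr p \<partial>\<mu>)"

lemma p_nonneg: "0 \<le> p" using p by simp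

lemma modular_nonneg: "modular f \<ge> 0"
  by (simp add: modular_def)

lemma Lp_measurable: "f \<in> vil_Lp m p \<Longrightarrow> f \<in> borel_measurable \<mu>"
  by (simp add: vil_Lp_def)

lemma Lp_integrable_powr: "f \<in> vil_Lp m p \<Longrightarrow> integrable \<mu> (\<lambda>x. norm (f x) powr p)"
  by (simp add: vil_Lp_def)

lemma Lp_bounded:
  assumes [measurable]: "f \<in> borel_measurable \<mu>" and bound: "\<And>x. norm (f x) \<le> B"
  shows "f \<in> vil_Lp m p"
  unfolding vil_Lp_def
  by (auto intro!: V.integrable_const_bound[where B = "B powr p"] AE_I2 powr_mono2 bound p_nonneg)

lemma Lp_dominated:
  assumes [measurable]: "f \<in> borel_measurable \<mu>" and g: "g \<in> vil_Lp m p"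
    and le: "\<And>x. x \<in> G \<Longrightarrow> norm (f x) \<le> c * norm (g x)" and c: "c \<ge> 0"
  shows "f \<in> vil_Lp m p"
proof -
  have "integrable \<mu> (\<lambda>x. norm (f x) powr p)"
  proof (rule Bochner_Integration.integrable_bound)
    show "integrable \<mu> (\<lambda>x. c powr p * norm (g x) powr p)"
      using Lp_integrable_powr[OF g] by simp
    show "AE x in \<mu>. norm (norm (f x) powr p) \<le> norm (c powr p * norm (g x) powr p)"
      using le p_nonneg c by (intro AE_I2) (auto simp: space_\<mu> powr_mult[symmetric] intro!: powr_mono2)
  qed simp
  then show ?thesis by (simp add: vil_Lp_def)
qed

lemma Lp_add:
  assumes "f \<in> vil_Lp m p" "g \<in> vil_Lp m p"
  shows "(\<lambda>x. f x + g x) \<in> vil_Lp m p"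
proof -
  have [measurable]: "f \<in> borel_measurable \<mu>" "g \<in> borel_measurable \<mu>"
    using assms by (auto simp: Lp_measurable)
  have "integrable \<mu> (\<lambda>x. norm (f x + g x) powr p)"
  proof (rule Bochner_Integration.integrable_bound)
    show "integrable \<mu> (\<lambda>x. 2 powr p * (norm (f x) powr p + norm (g x) powr p))"
      using assms by (auto simp: Lp_integrable_powr)
  qed (auto intro!: AE_I2 norm_add_powr_le p_nonneg)
  then show ?thesis by (simp add: vil_Lp_def)
qed

lemma Lp_scale:
  assumes "f \<in> vil_Lp m p"
  shows "(\<lambda>x. c * f x) \<in> vil_Lp m p"
  by (rule Lp_dominated[OF _ assms, of _ "norm c"]) (use Lp_measurable[OF assms] in \<open>auto simp: norm_mult\<close>)

lemma modular_add_le: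
  assumes "f \<in> vil_Lp m p" "g \<in> vil_Lp m p"
  shows "modular (\<lambda>x. f x + g x) \<le> 2 powr p * (modular f + modular g)"
proof -
  have "modular (\<lambda>x. f x + g x) \<le> (\<integral>x. 2 powr p * (norm (f x) powr p + norm (g x) powr p) \<partial>\<mu>)"
    unfolding modular_def using assms Lp_add[OF assms]
    by (intro integral_mono norm_add_powr_le p_nonneg) (auto simp: Lp_integrable_powr)
  also have "\<dots> = 2 powr p * (modular f + modular g)"
    unfolding modular_def using assms by (simp add: Lp_integrable_powr)
  finally show ?thesis .
qed

lemma modular_scale: "modular (\<lambda>x. c * f x) = norm c powr p * modular f"
  by (simp add: modular_def norm_mult powr_mult)

lemma Lp_integrable:
  assumes f: "f \<in> vil_Lp m p"
  shows "integrable \<mu> f"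
proof (rule Bochner_Integration.integrable_bound)
  show "integrable \<mu> (\<lambda>x. 1 + norm (f x) powr p)" using f by (simp add: Lp_integrable_powr)
  have "norm z \<le> 1 + norm z powr p" for z :: complex
    using powr_mono[of 1 p "norm z"] p by (cases "norm z \<le> 1") (auto intro: add_increasing2)
  then show "AE x in \<mu>. norm (f x) \<le> norm (1 + norm (f x) powr p)"
    by (intro AE_I2) (simp add: abs_of_nonneg add_nonneg_nonneg)
qed (simp add: Lp_measurable[OF f])

text \<open>\<open>4 * b ^ 2 * C\<close> from \<open>sum_weight_le\<close> times
  \<open>2 * b\<close> from \<open>integral_maj_le\<close>; the added 1 yields positivity from
  \<open>C_nonneg\<close>.\<close>

definition A :: real where "A = 8 * real b ^ 3 * C + 1"

lemma A_pos: "A > 0"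
  using C_nonneg by (simp add: A_def add_nonneg_pos)

lemma major_bounded: "norm (major n \<theta>) \<le> (\<Sum>l<Suc n. weight n l * (2 * real (M l)))"
  unfolding real_norm_def abs_of_nonneg[OF major_nonneg]
  unfolding major_def by (intro sum_mono mult_left_mono maj_le weight_nonneg)

lemma major_measurable [measurable]:
  "(\<lambda>z. major n (ratio (fst z) (snd z))) \<in> borel_measurable (\<mu> \<Otimes>\<^sub>M \<mu>)"
  unfolding major_def by measurable

lemma major_measurable_2: "x \<in> G \<Longrightarrow> (\<lambda>t. major n (ratio x t)) \<in> borel_measurable \<mu>"
  using measurable_compose[OF measurable_Pair1' major_measurable, of x n] by (simp add: space_\<mu>)

lemma major_commute: "major n (ratio x t) = major n (ratio t x)"
  by (simp add: major_def maj_commute[of x])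

lemma integrable_times_major:
  fixes g :: "(nat \<Rightarrow> int) \<Rightarrow> real"
  assumes "integrable \<mu> g" "x \<in> G"
  shows "integrable \<mu> (\<lambda>t. g t * major n (ratio x t))"
  using assms by (intro integrable_times_bounded[OF _ _ major_bounded]) (auto simp: major_measurable_2)

lemma integral_major_le:
  assumes x: "x \<in> G"
  shows "(\<integral>t. major n (ratio x t) \<partial>\<mu>) \<le> A"
proof -
  have "(\<integral>t. major n (ratio x t) \<partial>\<mu>) = (\<Sum>l<Suc n. weight n l * (\<integral>t. maj (ratio x t) l \<partial>\<mu>))"
    unfolding major_def using x
    by (subst Bochner_Integration.integral_sum) (auto intro!: integrable_mult_right integrable_maj)
  also have "\<dots> \<le> (\<Sum>l<Suc n. weight n l * (2 * real b))"
    using x by (intro sum_mono mult_left_mono integral_maj_le weight_nonneg)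
  also have "\<dots> = (\<Sum>l<Suc n. weight n l) * (2 * real b)" by (rule sum_distrib_right[symmetric])
  also have "\<dots> \<le> 4 * real b ^ 2 * C * (2 * real b)"
    by (intro mult_right_mono sum_weight_le) simp
  also have "\<dots> \<le> A" by (simp add: A_def power2_eq_square power3_eq_cube)
  finally show ?thesis .
qed

lemma norm_T_mean_le:
  assumes f: "integrable \<mu> f" and x: "x \<in> G"
  shows "norm (T_mean m q (Suc n) f x) \<le> (\<integral>t. norm (f t) * major n (ratio x t) \<partial>\<mu>)"
  unfolding T_mean_eq[OF f]
proof (rule order.trans[OF integral_norm_bound integral_mono])
  show "integrable \<mu> (\<lambda>t. norm (f t * kernel n (ratio x t)))"
    by (intro integrable_norm T_mean_eq f)
qed (use f x in \<open>auto simp: norm_mult norm_ratio ratio_power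
       intro!: integrable_times_major mult_left_mono norm_kernel_le\<close>)

text \<open>A T mean is a finite combination of characters, hence bounded, whatever \<open>f\<close>
  is.\<close>

lemma T_mean_Lp: "T_mean m q n f \<in> vil_Lp m p"
proof (rule Lp_bounded)
  have eq: "T_mean m q n f = (\<lambda>x. 1 / of_real (Q_sum q n) *
      (\<Sum>k<n. of_real (q k) * (\<Sum>j<k. vil_coeff m f j * vil_psi m j x)))"
    by (simp add: T_mean_def vil_S_def fun_eq_iff)
  show "T_mean m q n f \<in> borel_measurable \<mu>" unfolding eq by measurable
  show "norm (T_mean m q n f x) \<le> norm (1 / of_real (Q_sum q n) :: complex) *
      (\<Sum>k<n. norm (of_real (q k) :: complex) * (\<Sum>j<k. norm (vil_coeff m f j)))" for x
    unfolding eq norm_mult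
    by (intro mult_left_mono order.trans[OF norm_sum] sum_mono norm_ge_zero)
       (auto simp: norm_mult norm_psi intro!: mult_left_mono order.trans[OF norm_sum] sum_mono)
qed

text \<open>A Schur test: Jensen in \<open>t\<close> produces \<open>A powr (p - 1)\<close>, and
  after Fubini the symmetry of \<open>major\<close> lets the integral over \<open>x\<close> produce
  the remaining factor \<open>A\<close>.\<close>

lemma modular_T_mean_le:
  assumes f: "f \<in> vil_Lp m p"
  shows "modular (T_mean m q (Suc n) f) \<le> A powr p * modular f"
proof -
  have [measurable]: "f \<in> borel_measurable \<mu>" using f by (rule Lp_measurable)
  have fp: "integrable \<mu> (\<lambda>t. norm (f t) powr p)" using f by (rule Lp_integrable_powr)
  define h where "h x t = norm (f t) powr p * major n (ratio x t)" for x t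
  have int_f: "integrable (\<mu> \<Otimes>\<^sub>M \<mu>) (\<lambda>z. norm (f (snd z)) powr p)"
    by (rule VV.Fubini_integrable) (use fp in auto)
  have int_h: "integrable (\<mu> \<Otimes>\<^sub>M \<mu>) (case_prod h)"
    using integrable_times_bounded[OF int_f major_measurable major_bounded]
    by (simp add: h_def case_prod_beta')
  have "modular (T_mean m q (Suc n) f) \<le> (\<integral>x. A powr (p - 1) * (\<integral>t. h x t \<partial>\<mu>) \<partial>\<mu>)"
    unfolding modular_def
  proof (rule integral_mono)
    show "integrable \<mu> (\<lambda>x. norm (T_mean m q (Suc n) f x) powr p)"
      by (rule Lp_integrable_powr[OF T_mean_Lp])
    show "integrable \<mu> (\<lambda>x. A powr (p - 1) * (\<integral>t. h x t \<partial>\<mu>))"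
      using VV.integrable_fst[OF int_h] by simp
    fix x assume "x \<in> space \<mu>"
    then have x: "x \<in> G" by (simp add: space_\<mu>)
    have "norm (T_mean m q (Suc n) f x) powr p \<le> (\<integral>t. norm (f t) * major n (ratio x t) \<partial>\<mu>) powr p"
      using norm_T_mean_le[OF Lp_integrable[OF f] x] p by (intro powr_mono2) auto
    also have "\<dots> \<le> A powr (p - 1) * (\<integral>t. norm (f t) powr p * major n (ratio x t) \<partial>\<mu>)"
    proof (rule powr_integral_le[OF p])
      show "integrable \<mu> (\<lambda>t. major n (ratio x t))"
        using integrable_times_major[of "\<lambda>_. 1"] x by simp
    qed (use x fp Lp_integrable[OF f] in
          \<open>auto intro!: integrable_times_major integral_major_le A_pos major_nonneg\<close>)
    finally show "norm (T_mean m q (Suc n) f x) powr p \<le> A powr (p - 1) * (\<integral>t. h x t \<partial>\<mu>)"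
      by (simp add: h_def)
  qed
  also have "\<dots> = A powr (p - 1) * (\<integral>x. (\<integral>t. h x t \<partial>\<mu>) \<partial>\<mu>)" by simp
  also have "(\<integral>x. (\<integral>t. h x t \<partial>\<mu>) \<partial>\<mu>) = (\<integral>t. (\<integral>x. h x t \<partial>\<mu>) \<partial>\<mu>)"
    by (rule VV.Fubini_integral[OF int_h, symmetric])
  also have "\<dots> \<le> (\<integral>t. norm (f t) powr p * A \<partial>\<mu>)"
  proof (rule integral_mono)
    show "integrable \<mu> (\<lambda>t. (\<integral>x. h x t \<partial>\<mu>))"
      using VV.integrable_snd[OF int_h] .
    show "integrable \<mu> (\<lambda>t. norm (f t) powr p * A)" using fp by simp
    fix t assume "t \<in> space \<mu>"
    then have t: "t \<in> G" by (simp add: space_\<mu>)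
    have "(\<integral>x. h x t \<partial>\<mu>) = norm (f t) powr p * (\<integral>x. major n (ratio t x) \<partial>\<mu>)"
      by (simp add: h_def major_commute[of _ t])
    also have "\<dots> \<le> norm (f t) powr p * A"
      by (intro mult_left_mono integral_major_le t) simp
    finally show "(\<integral>x. h x t \<partial>\<mu>) \<le> norm (f t) powr p * A" .
  qed
  also have "\<dots> = modular f * A" by (simp add: modular_def)
  also have "A powr (p - 1) * (modular f * A) = A powr p * modular f"
    using A_pos by (simp add: powr_diff)
  finally show ?thesis by (simp add: mult_left_mono)
qed

lemma vil_coeff_add:
  "integrable \<mu> f \<Longrightarrow> integrable \<mu> g \<Longrightarrow>
    vil_coeff m (\<lambda>x. f x + g x) k = vil_coeff m f k + vil_coeff m g k"
  unfolding vil_coeff_def distrib_right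
  by (intro Bochner_Integration.integral_add integrable_times_psi)

lemma T_mean_add:
  "integrable \<mu> f \<Longrightarrow> integrable \<mu> g \<Longrightarrow>
    T_mean m q n (\<lambda>x. f x + g x) x = T_mean m q n f x + T_mean m q n g x"
  by (simp add: T_mean_def vil_S_def vil_coeff_add distrib_right distrib_left sum.distrib)

lemma T_mean_scale: "T_mean m q n (\<lambda>x. c * f x) x = c * T_mean m q n f x"
proof -
  have "vil_coeff m (\<lambda>x. c * f x) k = c * vil_coeff m f k" for k
    by (simp add: vil_coeff_def mult.assoc)
  then show ?thesis by (simp add: T_mean_def vil_S_def sum_distrib_left mult_ac)
qed

lemma T_mean_cong:
  assumes "\<And>x. x \<in> G \<Longrightarrow> f x = g x"
  shows "T_mean m q n f x = T_mean m q n g x"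
proof -
  have "vil_coeff m f k = vil_coeff m g k" for k
    unfolding vil_coeff_def using assms
    by (intro Bochner_Integration.integral_cong) (auto simp: space_\<mu>)
  then show ?thesis by (simp add: T_mean_def vil_S_def)
qed

section \<open>The class of functions whose T means converge in L_p\<close>

definition err :: "nat \<Rightarrow> ((nat \<Rightarrow> int) \<Rightarrow> complex) \<Rightarrow> (nat \<Rightarrow> int) \<Rightarrow> complex" where
  "err n f x = T_mean m q (Suc n) f x - f x"

definition approximable :: "((nat \<Rightarrow> int) \<Rightarrow> complex) \<Rightarrow> bool" where
  "approximable f \<longleftrightarrow> f \<in> vil_Lp m p \<and> (\<lambda>n. modular (err n f)) \<longlonglongrightarrow> 0"

lemma err_eq: "err n f = (\<lambda>x. T_mean m q (Suc n) f x + (- 1) * f x)"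
  by (simp add: err_def fun_eq_iff)

lemma err_Lp: "f \<in> vil_Lp m p \<Longrightarrow> err n f \<in> vil_Lp m p"
  unfolding err_eq by (intro Lp_add Lp_scale T_mean_Lp)

lemma modular_err_le:
  assumes "f \<in> vil_Lp m p"
  shows "modular (err n f) \<le> 2 powr p * (A powr p + 1) * modular f"
proof -
  have "modular (err n f) \<le> 2 powr p * (modular (T_mean m q (Suc n) f) + modular (\<lambda>x. (- 1) * f x))"
    unfolding err_eq by (intro modular_add_le T_mean_Lp Lp_scale assms)
  also have "modular (\<lambda>x. (- 1) * f x) = modular f" by (simp only: modular_scale) simp
  also have "modular (T_mean m q (Suc n) f) + modular f \<le> A powr p * modular f + modular f"
    using modular_T_mean_le[OF assms] by simp
  finally show ?thesis by (simp add: algebra_simps)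
qed

lemma approximable_add:
  assumes "approximable f" "approximable g"
  shows "approximable (\<lambda>x. f x + g x)"
proof -
  have Lp: "f \<in> vil_Lp m p" "g \<in> vil_Lp m p" using assms by (auto simp: approximable_def)
  have "err n (\<lambda>x. f x + g x) = (\<lambda>x. err n f x + err n g x)" for n
    using Lp by (simp add: err_def T_mean_add Lp_integrable fun_eq_iff)
  then have le: "modular (err n (\<lambda>x. f x + g x)) \<le> 2 powr p * (modular (err n f) + modular (err n g))" for n
    using modular_add_le[OF err_Lp[OF Lp(1)] err_Lp[OF Lp(2)]] by simp
  have "(\<lambda>n. 2 powr p * (modular (err n f) + modular (err n g))) \<longlonglongrightarrow> 2 powr p * (0 + 0)"
    using assms by (intro tendsto_intros) (auto simp: approximable_def)
  then have lim: "(\<lambda>n. 2 powr p * (modular (err n f) + modular (err n g))) \<longlonglongrightarrow> 0" by simp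
  have "(\<lambda>n. modular (err n (\<lambda>x. f x + g x))) \<longlonglongrightarrow> 0"
    using tendsto_sandwich[OF _ _ tendsto_const lim] le modular_nonneg by simp
  then show ?thesis using Lp by (simp add: approximable_def Lp_add)
qed

lemma approximable_scale:
  assumes "approximable f"
  shows "approximable (\<lambda>x. c * f x)"
proof -
  have "err n (\<lambda>x. c * f x) = (\<lambda>x. c * err n f x)" for n
    by (simp add: err_def T_mean_scale fun_eq_iff algebra_simps)
  moreover have "(\<lambda>n. norm c powr p * modular (err n f)) \<longlonglongrightarrow> 0"
    using assms by (intro tendsto_mult_right_zero) (auto simp: approximable_def)
  ultimately show ?thesis using assms by (simp add: approximable_def Lp_scale modular_scale)
qed

lemma approximable_cong:
  assumes "approximable f" and eq: "\<And>x. x \<in> G \<Longrightarrow> f x = g x"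
  shows "approximable g"
proof -
  have "modular (err n g) = modular (err n f)" for n
    unfolding modular_def err_def using eq T_mean_cong[OF eq]
    by (intro Bochner_Integration.integral_cong) (auto simp: space_\<mu>)
  moreover have "g \<in> vil_Lp m p"
  proof -
    have "f \<in> vil_Lp m p" using assms(1) by (simp add: approximable_def)
    moreover have "g \<in> borel_measurable \<mu> \<longleftrightarrow> f \<in> borel_measurable \<mu>"
      using eq by (intro measurable_cong) (simp add: space_\<mu>)
    moreover have "integrable \<mu> (\<lambda>x. norm (g x) powr p) \<longleftrightarrow> integrable \<mu> (\<lambda>x. norm (f x) powr p)"
      using eq by (intro Bochner_Integration.integrable_cong) (simp_all add: space_\<mu>)
    ultimately show ?thesis by (simp add: vil_Lp_def)
  qed
  ultimately show ?thesis using assms(1) by (simp add: approximable_def)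
qed

lemma approximable_0: "approximable (\<lambda>_. 0)"
proof -
  have "T_mean m q n (\<lambda>_. 0) x = 0" for n x using T_mean_scale[of n 0] by simp
  then have "modular (err n (\<lambda>_. 0)) = 0" for n using p by (simp add: err_def modular_def)
  moreover have "(\<lambda>_. 0) \<in> vil_Lp m p" by (rule Lp_bounded[of _ 0]) auto
  ultimately show ?thesis by (simp add: approximable_def)
qed

lemma approximable_sum:
  "finite S \<Longrightarrow> (\<And>i. i \<in> S \<Longrightarrow> approximable (f i)) \<Longrightarrow> approximable (\<lambda>x. \<Sum>i\<in>S. f i x)"
  by (induction S rule: finite_induct) (auto intro: approximable_0 approximable_add)

text \<open>With \<open>g i = f - F i\<close>, the error of \<open>f\<close> splits into that of
  \<open>F i\<close>, which vanishes as \<open>n\<close> grows, and that of \<open>g i\<close>,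
  which \<open>modular_err_le\<close> makes small uniformly in \<open>n\<close>. So \<open>i\<close>
  is fixed before \<open>n\<close>.\<close>

lemma approximable_limit:
  assumes F: "\<And>i. approximable (F i)" and f: "f \<in> vil_Lp m p"
    and lim: "(\<lambda>i. modular (\<lambda>x. f x + (- 1) * F i x)) \<longlonglongrightarrow> 0"
  shows "approximable f"
proof -
  define K where "K = 2 powr p * (A powr p + 1)"
  have FLp: "F i \<in> vil_Lp m p" for i using F by (simp add: approximable_def)
  define g where "g i = (\<lambda>x. f x + (- 1) * F i x)" for i
  have gLp: "g i \<in> vil_Lp m p" for i unfolding g_def by (intro Lp_add Lp_scale f FLp)
  have le: "modular (err n f) \<le> 2 powr p * (modular (err n (F i)) + K * modular (g i))" for n i
  proof -
    have f_eq: "f = (\<lambda>x. F i x + g i x)" by (simp add: g_def)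
    have "err n f = (\<lambda>x. err n (F i) x + err n (g i) x)"
      by (subst f_eq) (simp add: err_def fun_eq_iff T_mean_add Lp_integrable FLp gLp)
    then have "modular (err n f) \<le> 2 powr p * (modular (err n (F i)) + modular (err n (g i)))"
      using modular_add_le[OF err_Lp[OF FLp] err_Lp[OF gLp]] by simp
    also have "\<dots> \<le> 2 powr p * (modular (err n (F i)) + K * modular (g i))"
      using modular_err_le[OF gLp[of i], of n] by (intro mult_left_mono) (auto simp: K_def)
    finally show ?thesis .
  qed
  have "(\<lambda>n. modular (err n f)) \<longlonglongrightarrow> 0"
  proof (rule LIMSEQ_I)
    fix e :: real assume e: "e > 0"
    have "(\<lambda>i. 2 powr p * (K * modular (g i))) \<longlonglongrightarrow> 0"
      using lim unfolding g_def by (intro tendsto_mult_right_zero)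
    from LIMSEQ_D[OF this, of "e / 2"] obtain i where "norm (2 powr p * (K * modular (g i)) - 0) < e / 2"
      using e by auto
    then have i: "2 powr p * (K * modular (g i)) < e / 2" by simp
    have "(\<lambda>n. 2 powr p * modular (err n (F i))) \<longlonglongrightarrow> 0"
      using F[of i] by (intro tendsto_mult_right_zero) (auto simp: approximable_def)
    from LIMSEQ_D[OF this, of "e / 2"] obtain N
      where N: "\<And>n. n \<ge> N \<Longrightarrow> norm (2 powr p * modular (err n (F i)) - 0) < e / 2"
      using e by auto
    have "norm (modular (err n f) - 0) < e" if "n \<ge> N" for n
      using N[OF that] i le[of n i] modular_nonneg[of "err n f"] modular_nonneg[of "err n (F i)"]
      by (simp add: distrib_left)
    then show "\<exists>N. \<forall>n\<ge>N. norm (modular (err n f) - 0) < e" by blast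
  qed
  then show ?thesis using f by (simp add: approximable_def)
qed

lemma approximable_dominated:
  assumes F: "\<And>i. approximable (F i)" and f: "f \<in> vil_Lp m p" and h: "h \<in> vil_Lp m p"
    and lim: "\<And>x. x \<in> G \<Longrightarrow> (\<lambda>i. F i x) \<longlonglongrightarrow> f x"
    and le: "\<And>i x. x \<in> G \<Longrightarrow> norm (F i x) \<le> norm (h x)"
  shows "approximable f"
proof (rule approximable_limit[OF F f])
  have [measurable]: "f \<in> borel_measurable \<mu>" "h \<in> borel_measurable \<mu>" "F i \<in> borel_measurable \<mu>" for i
    using f h F[of i] by (auto simp: approximable_def Lp_measurable)
  have "(\<lambda>i. modular (\<lambda>x. f x + (- 1) * F i x)) \<longlonglongrightarrow> (\<integral>x. 0 \<partial>\<mu>)"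
    unfolding modular_def
  proof (rule integral_dominated_convergence)
    show "integrable \<mu> (\<lambda>x. 2 powr p * (norm (f x) powr p + norm (h x) powr p))"
      using f h by (auto simp: Lp_integrable_powr)
    show "AE x in \<mu>. (\<lambda>i. norm (f x + (- 1) * F i x) powr p) \<longlonglongrightarrow> 0"
    proof (rule AE_I2)
      fix x assume "x \<in> space \<mu>"
      then have "(\<lambda>i. norm (f x + (- 1) * F i x)) \<longlonglongrightarrow> norm (f x + (- 1) * f x)"
        by (intro tendsto_intros lim) (simp add: space_\<mu>)
      then have "(\<lambda>i. norm (f x + (- 1) * F i x)) \<longlonglongrightarrow> 0" by simp
      then show "(\<lambda>i. norm (f x + (- 1) * F i x) powr p) \<longlonglongrightarrow> 0"
        using p by (intro tendsto_zero_powrI[OF _ tendsto_const]) auto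
    qed
    show "AE x in \<mu>. norm (norm (f x + (- 1) * F i x) powr p) \<le>
        2 powr p * (norm (f x) powr p + norm (h x) powr p)" for i
    proof (rule AE_I2)
      fix x assume x: "x \<in> space \<mu>"
      have "norm (f x + (- 1) * F i x) powr p \<le>
          2 powr p * (norm (f x) powr p + norm ((- 1) * F i x) powr p)"
        by (rule norm_add_powr_le[OF p_nonneg])
      also have "\<dots> \<le> 2 powr p * (norm (f x) powr p + norm (h x) powr p)"
        using le[of x i] x p_nonneg by (intro mult_left_mono add_left_mono powr_mono2) (auto simp: space_\<mu>)
      finally show "norm (norm (f x + (- 1) * F i x) powr p) \<le>
          2 powr p * (norm (f x) powr p + norm (h x) powr p)" by simp
    qed
  qed auto
  then show "(\<lambda>i. modular (\<lambda>x. f x + (- 1) * F i x)) \<longlonglongrightarrow> 0" by simp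
qed

text \<open>Such an \<open>f\<close> is continuous at every point, so its T means converge
  everywhere on \<open>G\<close>; being bounded by \<open>A\<close> there, they allow dominated
  convergence.\<close>

lemma approximable_locally_constant:
  assumes [measurable]: "f \<in> borel_measurable \<mu>" and bound: "\<And>x. norm (f x) \<le> 1"
    and const: "\<And>x t. x \<in> G \<Longrightarrow> t \<in> vil_I m N x \<Longrightarrow> f t = f x"
  shows "approximable f"
proof -
  have Lp: "f \<in> vil_Lp m p" by (rule Lp_bounded[OF assms(1) bound])
  note int = Lp_integrable[OF Lp]
  have lim: "(\<lambda>n. T_mean m q n f x) \<longlonglongrightarrow> f x" if x: "x \<in> G" for x
  proof (rule T_mean_tendsto[OF int x deviation_tendsto_0_continuous[OF int x]])
    fix e :: real assume "e > 0"
    then show "\<exists>N. \<forall>t\<in>vil_I m N x. norm (f t - f x) < e"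
      using const[OF x] by (intro exI[of _ N]) auto
  qed
  have "(\<lambda>n. modular (err n f)) \<longlonglongrightarrow> (\<integral>x. 0 \<partial>\<mu>)"
    unfolding modular_def
  proof (rule integral_dominated_convergence)
    show "integrable \<mu> (\<lambda>x. (A + 1) powr p)" by simp
    show "(\<lambda>x. norm (err n f x) powr p) \<in> borel_measurable \<mu>" for n
      using Lp_measurable[OF err_Lp[OF Lp]] by measurable
    show "AE x in \<mu>. (\<lambda>n. norm (err n f x) powr p) \<longlonglongrightarrow> 0"
    proof (rule AE_I2)
      fix x assume "x \<in> space \<mu>"
      then have "(\<lambda>n. norm (err n f x)) \<longlonglongrightarrow> norm (f x - f x)"
        unfolding err_def by (intro tendsto_intros LIMSEQ_Suc lim) (simp add: space_\<mu>)
      then have "(\<lambda>n. norm (err n f x)) \<longlonglongrightarrow> 0" by simp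
      then show "(\<lambda>n. norm (err n f x) powr p) \<longlonglongrightarrow> 0"
        using p by (intro tendsto_zero_powrI[OF _ tendsto_const]) auto
    qed
    show "AE x in \<mu>. norm (norm (err n f x) powr p) \<le> (A + 1) powr p" for n
    proof (rule AE_I2)
      fix x assume "x \<in> space \<mu>"
      then have x: "x \<in> G" by (simp add: space_\<mu>)
      have "norm (T_mean m q (Suc n) f x) \<le> (\<integral>t. norm (f t) * major n (ratio x t) \<partial>\<mu>)"
        by (rule norm_T_mean_le[OF int x])
      also have "\<dots> \<le> (\<integral>t. 1 * major n (ratio x t) \<partial>\<mu>)"
        using int x by (intro integral_mono integrable_times_major mult_right_mono bound major_nonneg) auto
      also have "\<dots> \<le> A" using integral_major_le[OF x] by simp
      finally have "norm (err n f x) \<le> A + 1"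
        using bound[of x] norm_triangle_ineq4[of "T_mean m q (Suc n) f x" "f x"] by (simp add: err_def)
      then show "norm (norm (err n f x) powr p) \<le> (A + 1) powr p"
        using p by (simp add: powr_mono2)
    qed
  qed simp
  then show ?thesis using Lp by (simp add: approximable_def)
qed

text \<open>Dynkin induction over the product algebra. A generator constrains finitely many
  coordinates, so its indicator is locally constant; a countable disjoint union is a dominated limit
  of finite ones.\<close>

lemma approximable_indicator:
  assumes "S \<in> sets \<mu>"
  shows "approximable (indicator S)"
proof -
  define Z where "Z = (\<lambda>k. uniform_count_measure (carrier (vil_Z m k)))"
  define \<Omega> where "\<Omega> = (\<Pi>\<^sub>E k\<in>(UNIV :: nat set). space (Z k))"
  have sets: "sets \<mu> = sigma_sets \<Omega> (prod_algebra UNIV Z)"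
    unfolding vil_measure_def Z_def[symmetric] \<Omega>_def by (rule sets_PiM)
  have \<Omega>: "\<Omega> = G"
    by (simp add: \<Omega>_def Z_def vil_group_def space_uniform_count_measure)
  have G: "approximable (indicator G)"
    by (rule approximable_locally_constant[where N = 0])
       (auto simp: indicator_def vil_I_def space_\<mu>[symmetric])
  show ?thesis
    using Int_stable_prod_algebra prod_algebra_sets_into_space[of UNIV Z, folded \<Omega>_def] assms[unfolded sets]
  proof (induction rule: sigma_sets_induct_disjoint)
    case (basic S)
    then have S_sets: "S \<in> sets \<mu>" by (auto simp: sets)
    from basic obtain J X where S: "S = prod_emb UNIV Z J (\<Pi>\<^sub>E j\<in>J. X j)" "finite J"
      by (metis prod_algebraE)
    obtain N where N: "J \<subseteq> {..<N}" using S(2) finite_nat_iff_bounded by blast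
    show ?case
    proof (rule approximable_locally_constant[where N = N])
      show "indicator S t = (indicator S x :: complex)" if "x \<in> G" "t \<in> vil_I m N x" for x t
      proof -
        have "t \<in> S \<longleftrightarrow> x \<in> S"
          using that N \<Omega>
          by (auto simp: S prod_emb_def vil_I_def PiE_iff subset_eq \<Omega>_def)
        then show ?thesis by (simp add: indicator_def)
      qed
    qed (use S_sets in \<open>auto simp: indicator_def\<close>)
  next
    case empty
    show ?case using approximable_0 by (simp add: indicator_def)
  next
    case (compl S)
    have "S \<subseteq> \<Omega>" using compl(1) sets.sets_into_space[of S \<mu>] by (simp add: sets space_\<mu> \<Omega>)
    then have "(indicator (\<Omega> - S) :: _ \<Rightarrow> complex) = (\<lambda>x. indicator G x + (- 1) * indicator S x)"
      by (auto simp: \<Omega> indicator_def fun_eq_iff)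
    then show ?case using approximable_add[OF G approximable_scale[OF compl(2), of "- 1"]] by simp
  next
    case (union S)
    have [measurable]: "S i \<in> sets \<mu>" for i using union(2) by (auto simp: sets)
    define F :: "nat \<Rightarrow> (nat \<Rightarrow> int) \<Rightarrow> complex" where "F k = indicator (\<Union>i<k. S i)" for k
    show ?case
    proof (rule approximable_dominated[where F = F and h = "\<lambda>_. 1"])
      show "approximable (F k)" for k
      proof (induction k)
        case 0
        show ?case using approximable_0 by (simp add: F_def indicator_def)
      next
        case (Suc k)
        have "S i \<inter> S k = {}" if "i < k" for i
          using union(1) that by (auto simp: disjoint_family_on_def)
        then have "F (Suc k) = (\<lambda>x. F k x + indicator (S k) x)"
          by (auto simp: F_def fun_eq_iff indicator_def less_Suc_eq)
        then show ?case using approximable_add[OF Suc union(3)] by simp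
      qed
      show "(indicator (\<Union>i. S i) :: _ \<Rightarrow> complex) \<in> vil_Lp m p"
        by (rule Lp_bounded[where B = 1]) (auto simp: indicator_def)
      show "(\<lambda>_. 1 :: complex) \<in> vil_Lp m p" by (rule Lp_bounded[where B = 1]) auto
      show "(\<lambda>k. F k x) \<longlonglongrightarrow> indicator (\<Union>i. S i) x" for x
      proof (cases "x \<in> (\<Union>i. S i)")
        case True
        then obtain i where "x \<in> S i" by auto
        then have "F k x = indicator (\<Union>i. S i) x" if "k \<ge> Suc i" for k
          using that by (auto simp: F_def indicator_def)
        then show ?thesis by (intro tendsto_eventually eventually_sequentiallyI[of "Suc i"])
      next
        case False
        then have "F k x = indicator (\<Union>i. S i) x" for k by (auto simp: F_def indicator_def)
        then show ?thesis by simp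
      qed
      show "norm (F k x) \<le> norm (1 :: complex)" for k x by (simp add: F_def indicator_def)
    qed
  qed
qed

lemma approximable_Lp:
  assumes f: "f \<in> vil_Lp m p"
  shows "approximable f"
proof -
  obtain F where F: "\<And>i. simple_function \<mu> (F i)" "\<And>x. x \<in> space \<mu> \<Longrightarrow> (\<lambda>i. F i x) \<longlonglongrightarrow> f x"
    "\<And>i x. x \<in> space \<mu> \<Longrightarrow> norm (F i x) \<le> 2 * norm (f x)"
    \<comment> \<open>Base point 0 turns the metric estimate into
      \<open>norm (F i x) \<le> 2 * norm (f x)\<close>, so \<open>2 * f\<close> dominates.\<close>
    using borel_measurable_implies_sequence_metric[OF Lp_measurable[OF f], of 0]
    unfolding dist_0_norm dist_norm diff_zero by metis
  show ?thesis
  proof (rule approximable_dominated[where F = F and h = "\<lambda>x. 2 * f x"])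
    show "approximable (F i)" for i
    proof (rule approximable_cong)
      show "approximable (\<lambda>x. \<Sum>y\<in>F i ` space \<mu>. y * indicator (F i -` {y} \<inter> space \<mu>) x)"
        using F(1)[of i]
        by (intro approximable_sum approximable_scale approximable_indicator)
           (auto dest: simple_functionD)
      show "(\<Sum>y\<in>F i ` space \<mu>. y * indicator (F i -` {y} \<inter> space \<mu>) x) = F i x" if "x \<in> G" for x
      proof -
        have "y * indicator S x = indicator S x *\<^sub>R y" for y :: complex and S
          by (simp add: indicator_def)
        then show ?thesis
          using simple_function_indicator_representation_banach[OF F(1), of x i] that
          by (simp only: space_\<mu>)
      qed
    qed
  qed (use f F in \<open>auto simp: space_\<mu> norm_mult intro: Lp_scale\<close>)
qed

lemma vil_norm_T_mean_tendsto:
  assumes f: "f \<in> vil_Lp m p"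
  shows "(\<lambda>n. vil_norm m p (\<lambda>x. T_mean m q n f x - f x)) \<longlonglongrightarrow> 0"
proof (rule LIMSEQ_imp_Suc)
  have "(\<lambda>n. modular (err n f) powr (1 / p)) \<longlonglongrightarrow> 0"
    using approximable_Lp[OF f] p modular_nonneg
    by (intro tendsto_zero_powrI[OF _ tendsto_const]) (auto simp: approximable_def)
  then show "(\<lambda>n. vil_norm m p (\<lambda>x. T_mean m q (Suc n) f x - f x)) \<longlonglongrightarrow> 0"
    by (simp add: vil_norm_def modular_def err_def)
qed

end

subsection \<open>The two classes of weights\<close>

context bounded_vilenkin
begin

text \<open>A basic open box around \<open>x\<close> constrains finitely many coordinates and so
  contains I_N(x) once \<open>N\<close> exceeds all of them.\<close>

lemma topcontinuous_at_vil_topD: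
  assumes cont: "topcontinuous_at (vil_top m) euclidean f x"
    and e: "e > (0 :: real)"
  shows "\<exists>N. \<forall>t\<in>vil_I m N x. norm (f t - f x :: complex) < e"
proof -
  obtain U where U: "openin (vil_top m) U" "x \<in> U" "\<And>y. y \<in> U \<Longrightarrow> f y \<in> ball (f x) e"
    using cont e unfolding topcontinuous_at_def by (metis centre_in_ball open_ball open_openin)
  then obtain V where V: "finite {k. V k \<noteq> carrier (vil_Z m k)}" "x \<in> Pi\<^sub>E UNIV V" "Pi\<^sub>E UNIV V \<subseteq> U"
    unfolding vil_top_def openin_product_topology_alt by auto
  obtain N where N: "{k. V k \<noteq> carrier (vil_Z m k)} \<subseteq> {..<N}"
    using V(1) finite_nat_iff_bounded by blast
  have in_V: "t \<in> Pi\<^sub>E UNIV V" if t: "t \<in> vil_I m N x" for t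
    unfolding PiE_UNIV_domain
  proof
    fix k
    show "t k \<in> V k"
    proof (cases "k < N")
      case True
      then have "t k = x k" using t by (simp add: vil_I_def)
      then show ?thesis using V(2) by auto
    next
      case False
      then have "V k = carrier (vil_Z m k)" using N by auto
      then show ?thesis using t by (auto simp: vil_I_def vil_group_def)
    qed
  qed
  have "norm (f t - f x) < e" if "t \<in> vil_I m N x" for t
    using U(3)[OF subsetD[OF V(3) in_V[OF that]]] by (simp add: dist_norm norm_minus_commute)
  then show ?thesis by blast
qed

text \<open>By telescoping, the left side of \<open>weight_bound\<close> equals
  \<open>Q_sum q (Suc n)\<close>, so the constant is 1. The numerator in \<open>variation\<close> is
  always \<open>q 0\<close>, and divergence of \<open>Q_sum q\<close> finishes.\<close>

lemma weights_decseq: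
  assumes q: "\<And>k. q k \<ge> 0" "q 0 > 0" and dec: "decseq q"
    and Q: "filterlim (Q_sum q) at_top sequentially"
  shows "vilenkin_weights m b q 1"
proof
  have abs: "\<bar>q k - q (Suc k)\<bar> = q k - q (Suc k)" for k
    using decseq_SucD[OF dec, of k] by simp
  show "q n * real (Suc n) + (\<Sum>k<n. \<bar>q k - q (Suc k)\<bar> * real (Suc k)) \<le> 1 * Q_sum q (Suc n)" for n
  proof (induction n)
    case (Suc n)
    then show ?case unfolding abs by (simp add: Q_sum_def algebra_simps)
  qed (simp add: Q_sum_def)
  have "filterlim (\<lambda>n. Q_sum q (Suc n)) at_infinity sequentially"
    using Q by (intro filterlim_at_top_imp_at_infinity) (simp only: filterlim_sequentially_Suc)
  then have "(\<lambda>n. q 0 / Q_sum q (Suc n)) \<longlonglongrightarrow> 0"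
    by (rule tendsto_divide_0[OF tendsto_const])
  moreover have "q n + (\<Sum>k<n. \<bar>q k - q (Suc k)\<bar>) = q 0" for n
    unfolding abs by (induction n) simp_all
  ultimately show "(\<lambda>n. (q n + (\<Sum>k<n. \<bar>q k - q (Suc k)\<bar>)) / Q_sum q (Suc n)) \<longlonglongrightarrow> 0"
    by simp
qed (use q in auto)

text \<open>The differences change sign, so the weighted variation is
  \<open>q n * Suc n - Q_sum q (Suc n)\<close> and the left side of \<open>weight_bound\<close> is
  at most \<open>2 * q n * Suc n\<close>. A bound \<open>B\<close> on
  \<open>q n * Suc n / Q_sum q (Suc n)\<close> thus gives the constant \<open>2 * B\<close> and the
  decay \<open>2 * B / Suc n\<close> for \<open>variation\<close>.\<close>

lemma weights_incseq:
  assumes q: "\<And>k. q k \<ge> 0" "q 0 > 0" and inc: "incseq q"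
    and O: "(\<lambda>n. q (n - 1) / Q_sum q n) \<in> O(\<lambda>n. 1 / real n)"
  obtains C where "vilenkin_weights m b q C"
proof -
  have Q_pos: "Q_sum q (Suc n) > 0" for n
    unfolding Q_sum_def lessThan_Suc_eq_insert_0 using q
    by (subst sum.insert) (auto intro!: add_pos_nonneg sum_nonneg)
  have abs: "\<bar>q k - q (Suc k)\<bar> = q (Suc k) - q k" for k
    using incseq_SucD[OF inc, of k] by simp
  obtain c where "\<forall>\<^sub>F n in sequentially. norm (q (n - 1) / Q_sum q n) \<le> c * norm (1 / real n)"
    using landau_o.bigE[OF O] by blast
  then have "\<forall>\<^sub>F n in sequentially. norm (q n / Q_sum q (Suc n)) \<le> c * norm (1 / real (Suc n))"
    by (subst (asm) eventually_sequentially_Suc[symmetric]) simp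
  then have "\<forall>\<^sub>F n in sequentially. norm (q n * real (Suc n) / Q_sum q (Suc n)) \<le> c"
    by eventually_elim (simp add: field_simps abs_mult del: of_nat_Suc)
  \<comment> \<open>The order estimate holds only for large \<open>n\<close>; boundedness of the
    whole sequence gives a constant valid for every \<open>n\<close>, as \<open>weight_bound\<close>
    requires.\<close>
  then have "Bseq (\<lambda>n. q n * real (Suc n) / Q_sum q (Suc n))" by (rule BfunI)
  then obtain B where "\<And>n. norm (q n * real (Suc n) / Q_sum q (Suc n)) \<le> B"
    unfolding Bseq_def by blast
  then have "q n * real (Suc n) / Q_sum q (Suc n) \<le> B" for n
    by (metis abs_le_D1 real_norm_def)
  then have B: "q n * real (Suc n) \<le> B * Q_sum q (Suc n)" for n
    using Q_pos[of n] by (simp add: divide_le_eq)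
  have "vilenkin_weights m b q (2 * B)"
  proof
    fix n
    have "(\<Sum>k<n. \<bar>q k - q (Suc k)\<bar> * real (Suc k)) = q n * real (Suc n) - Q_sum q (Suc n)"
      unfolding abs by (induction n) (simp_all add: Q_sum_def algebra_simps)
    then show "q n * real (Suc n) + (\<Sum>k<n. \<bar>q k - q (Suc k)\<bar> * real (Suc k)) \<le> 2 * B * Q_sum q (Suc n)"
      using B[of n] Q_pos[of n] by simp
  next
    have sum: "q n + (\<Sum>k<n. \<bar>q k - q (Suc k)\<bar>) = 2 * q n - q 0" for n
      unfolding abs by (induction n) simp_all
    have le: "(2 * q n - q 0) / Q_sum q (Suc n) \<le> 2 * B / real (Suc n)" for n
    proof -
      have "(2 * q n - q 0) / Q_sum q (Suc n) \<le> 2 * q n / Q_sum q (Suc n)"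
        using q Q_pos[of n] by (intro divide_right_mono) auto
      also have "\<dots> \<le> 2 * B / real (Suc n)"
        using B[of n] Q_pos[of n] by (simp add: field_simps del: of_nat_Suc)
      finally show ?thesis .
    qed
    have ge: "0 \<le> (2 * q n - q 0) / Q_sum q (Suc n)" for n
      using incseqD[OF inc, of 0 n] q(1)[of n] Q_pos[of n] by (intro divide_nonneg_pos) auto
    have "(\<lambda>n. 2 * B / real (Suc n)) \<longlonglongrightarrow> 0"
      using LIMSEQ_Suc[OF lim_const_over_n[of "2 * B"]] by simp
    from tendsto_sandwich[OF _ _ tendsto_const this]
    show "(\<lambda>n. (q n + (\<Sum>k<n. \<bar>q k - q (Suc k)\<bar>)) / Q_sum q (Suc n)) \<longlonglongrightarrow> 0"
      unfolding sum using le ge by simp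
  qed (use q in auto)
  then show ?thesis by (rule that)
qed

end

context vilenkin_weights_Lp
begin

lemma T_mean_convergence:
  "(\<forall>f \<in> vil_Lp m p. (\<lambda>n. vil_norm m p (\<lambda>x. T_mean m q n f x - f x)) \<longlonglongrightarrow> 0) \<and>
   (\<forall>f \<in> vil_Lp m 1. \<forall>x \<in> carrier (vil_group m).
      topcontinuous_at (vil_top m) euclidean f x \<longrightarrow> (\<lambda>n. T_mean m q n f x) \<longlonglongrightarrow> f x) \<and>
   (\<forall>f \<in> vil_Lp m p. \<forall>x. vil_lebesgue_point m f x \<longrightarrow> (\<lambda>n. T_mean m q n f x) \<longlonglongrightarrow> f x)"
proof (intro conjI ballI allI impI)
  fix f assume "f \<in> vil_Lp m p"
  then show "(\<lambda>n. vil_norm m p (\<lambda>x. T_mean m q n f x - f x)) \<longlonglongrightarrow> 0"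
    by (rule vil_norm_T_mean_tendsto)
next
  fix f x assume f: "f \<in> vil_Lp m 1" and x: "x \<in> G"
    and cont: "topcontinuous_at (vil_top m) euclidean f x"
  have int: "integrable \<mu> f" using f by (simp add: Lp_1_iff)
  show "(\<lambda>n. T_mean m q n f x) \<longlonglongrightarrow> f x"
    by (intro T_mean_tendsto deviation_tendsto_0_continuous int x topcontinuous_at_vil_topD[OF cont])
next
  fix f x assume "vil_lebesgue_point m f x"
  then have "integrable \<mu> f" "x \<in> G" "(\<lambda>n. vil_W m n f x) \<longlonglongrightarrow> 0"
    by (auto simp: vil_lebesgue_point_def Lp_1_iff)
  then show "(\<lambda>n. T_mean m q n f x) \<longlonglongrightarrow> f x"
    by (intro T_mean_tendsto deviation_tendsto_0_lebesgue)
qed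

end

theorem theorem1:
  fixes m :: "nat \<Rightarrow> nat" and p :: real and q :: "nat \<Rightarrow> real"
  assumes "\<And>k. m k \<ge> 2" and "bdd_above (range m)"
    and "1 \<le> p"
    and "\<And>k. q k \<ge> 0" and "q 0 > 0"
  shows "(decseq q \<and> filterlim (Q_sum q) at_top sequentially \<longrightarrow>
      (\<forall>f \<in> vil_Lp m p. (\<lambda>n. vil_norm m p (\<lambda>x. T_mean m q n f x - f x)) \<longlonglongrightarrow> 0) \<and>
      (\<forall>f \<in> vil_Lp m 1. \<forall>x \<in> carrier (vil_group m).
         topcontinuous_at (vil_top m) euclidean f x \<longrightarrow> (\<lambda>n. T_mean m q n f x) \<longlonglongrightarrow> f x) \<and>
      (\<forall>f \<in> vil_Lp m p. \<forall>x. vil_lebesgue_point m f x \<longrightarrow> (\<lambda>n. T_mean m q n f x) \<longlonglongrightarrow> f x)) \<and>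
    (incseq q \<and> (\<lambda>n. q (n - 1) / Q_sum q n) \<in> O(\<lambda>n. 1 / real n) \<longrightarrow>
      (\<forall>f \<in> vil_Lp m p. (\<lambda>n. vil_norm m p (\<lambda>x. T_mean m q n f x - f x)) \<longlonglongrightarrow> 0) \<and>
      (\<forall>f \<in> vil_Lp m 1. \<forall>x \<in> carrier (vil_group m).
         topcontinuous_at (vil_top m) euclidean f x \<longrightarrow> (\<lambda>n. T_mean m q n f x) \<longlonglongrightarrow> f x) \<and>
      (\<forall>f \<in> vil_Lp m p. \<forall>x. vil_lebesgue_point m f x \<longrightarrow> (\<lambda>n. T_mean m q n f x) \<longlonglongrightarrow> f x))"
proof -
  obtain b where b: "\<And>k. m k \<le> b"
    using assms(2) by (auto simp: bdd_above_def)
  interpret bounded_vilenkin m b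
    using assms(1) b by unfold_locales
  have *: "vilenkin_weights_Lp m b q C p" if "vilenkin_weights m b q C" for C
    using that assms(3) by (simp add: vilenkin_weights_Lp_def vilenkin_weights_Lp_axioms_def)
  show ?thesis
  proof (intro conjI[of "_ \<longrightarrow> _"] impI; elim conjE)
    assume "decseq q" "filterlim (Q_sum q) at_top sequentially"
    note conv = vilenkin_weights_Lp.T_mean_convergence[OF *[OF weights_decseq[OF assms(4,5) this]]]
    show "(\<forall>f \<in> vil_Lp m p. (\<lambda>n. vil_norm m p (\<lambda>x. T_mean m q n f x - f x)) \<longlonglongrightarrow> 0) \<and>
      (\<forall>f \<in> vil_Lp m 1. \<forall>x \<in> carrier (vil_group m).
         topcontinuous_at (vil_top m) euclidean f x \<longrightarrow> (\<lambda>n. T_mean m q n f x) \<longlonglongrightarrow> f x) \<and>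
      (\<forall>f \<in> vil_Lp m p. \<forall>x. vil_lebesgue_point m f x \<longrightarrow> (\<lambda>n. T_mean m q n f x) \<longlonglongrightarrow> f x)"
      by (rule conv)
  next
    assume "incseq q" "(\<lambda>n. q (n - 1) / Q_sum q n) \<in> O(\<lambda>n. 1 / real n)"
    then obtain C where "vilenkin_weights m b q C"
      using weights_incseq assms(4,5) by blast
    note conv = vilenkin_weights_Lp.T_mean_convergence[OF *[OF this]]
    show "(\<forall>f \<in> vil_Lp m p. (\<lambda>n. vil_norm m p (\<lambda>x. T_mean m q n f x - f x)) \<longlonglongrightarrow> 0) \<and>
      (\<forall>f \<in> vil_Lp m 1. \<forall>x \<in> carrier (vil_group m).
         topcontinuous_at (vil_top m) euclidean f x \<longrightarrow> (\<lambda>n. T_mean m q n f x) \<longlonglongrightarrow> f x) \<and>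
      (\<forall>f \<in> vil_Lp m p. \<forall>x. vil_lebesgue_point m f x \<longrightarrow> (\<lambda>n. T_mean m q n f x) \<longlonglongrightarrow> f x)"
      by (rule conv)
  qed
qed

end
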